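(* Let $G$ be a $2$-connected non-hamiltonian finite simple graph with minimum degree $\delta(G)\ge 3$. If $c'(G)\le 6$, then $c(G)\ge c'(G)+2$.
   Context: The circumference $c(G)$ of a graph $G$ is the length of a longest cycle in $G$. The induced circumference $c'(G)$ is the length of a longest induced (chordless) cycle in $G$. *)

theory Defs
  imports "Graph_Theory.Graph_Theory"
begin

text \<open>
  Finite simple graphs are those satisfying \<^const>\<open>graph\<close>: an undirected edge is a
  pair of opposite arcs. The library's cycles therefore include the closed walks \<open>u, v, u\<close>
  of length 2, which traverse a single undirected edge back and forth; requiring length at
  least 3 leaves exactly the cycles of the undirected graph.
\<close>

definition ucycle :: "('a, 'b) pre_digraph \<Rightarrow> 'b list \<Rightarrow> bool" where
  "ucycle G p \<longleftrightarrow> pre_digraph.cycle G p \<and> 3 \<le> length p"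

definition cycle_verts :: "('a, 'b) pre_digraph \<Rightarrow> 'b list \<Rightarrow> 'a set" where
  "cycle_verts G p = tail G ` set p"

definition chord :: "('a, 'b) pre_digraph \<Rightarrow> 'b list \<Rightarrow> 'a \<Rightarrow> 'a \<Rightarrow> bool" where
  "chord G p u v \<longleftrightarrow> u \<in> cycle_verts G p \<and> v \<in> cycle_verts G p \<and> u \<rightarrow>\<^bsub>G\<^esub> v \<and>
     (u, v) \<notin> arc_to_ends G ` set p \<and> (v, u) \<notin> arc_to_ends G ` set p"

definition induced_cycle :: "('a, 'b) pre_digraph \<Rightarrow> 'b list \<Rightarrow> bool" where
  "induced_cycle G p \<longleftrightarrow> ucycle G p \<and> (\<nexists>u v. chord G p u v)"

definition hamiltonian :: "('a, 'b) pre_digraph \<Rightarrow> bool" where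
  "hamiltonian G \<longleftrightarrow> (\<exists>p. ucycle G p \<and> cycle_verts G p = verts G)"

text \<open>
  The next three notions are unspecified for an acyclic graph, respectively for the graph
  without vertices.
\<close>

definition circumference :: "('a, 'b) pre_digraph \<Rightarrow> nat" where
  "circumference G = Max {length p | p. ucycle G p}"

definition induced_circumference :: "('a, 'b) pre_digraph \<Rightarrow> nat" where
  "induced_circumference G = Max {length p | p. induced_cycle G p}"

definition min_degree :: "('a, 'b) pre_digraph \<Rightarrow> nat" where
  "min_degree G = Min (out_degree G ` verts G)"

definition k_connected :: "nat \<Rightarrow> ('a, 'b) pre_digraph \<Rightarrow> bool" where
  "k_connected k G \<longleftrightarrow> k < card (verts G) \<and>
     (\<forall>X. X \<subseteq> verts G \<and> card X < k \<longrightarrow> connected (G \<restriction> (verts G - X)))"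

end

theory Submission
  imports Defs
begin

text \<open>
  Let \<open>C\<close> be a longest induced cycle, of length \<open>k \<le> 6\<close>, and suppose that no cycle is longer
  than \<open>k + 1\<close>. Since \<open>C\<close> is induced, each of its vertices has a neighbour off \<open>C\<close>, and as \<open>G\<close> is
  not hamiltonian there are at least two vertices off \<open>C\<close>. By 2-connectivity every edge leaving
  a vertex set extends to a path returning to the set at another vertex (an ear).

  If two vertices off \<open>C\<close> are adjacent, some ear of \<open>C\<close> has at least two interior vertices. The
  length bound forces its ends to be at distance at least two on \<open>C\<close>, and the ear of a vertex
  of \<open>C\<close> between these ends then either closes a long cycle or yields a theta graph whose three
  branches have 2, 2 and 2 or 3 interior vertices. In such a theta graph further ears, provided by
  the minimum degree and the absence of chords in \<open>C\<close>, close a cycle of length at least \<open>k + 2\<close>.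

  Otherwise every vertex off \<open>C\<close> has at least three neighbours on \<open>C\<close> and none elsewhere. Two such
  vertices can be inserted into \<open>C\<close> when they are adjacent to the ends of distinct edges of \<open>C\<close>,
  or, for \<open>k = 6\<close>, when one is adjacent to alternate vertices and the other to their successors;
  one of these situations always occurs.
\<close>

section \<open>Paths and ears in 2-connected graphs\<close>

text \<open>The list \<open>P\<close> contains only the interior vertices.\<close>

definition trail_via :: "('a \<Rightarrow> 'a \<Rightarrow> bool) \<Rightarrow> 'a \<Rightarrow> 'a list \<Rightarrow> 'a \<Rightarrow> bool" where
  "trail_via E x P z \<longleftrightarrow> successively E (x # P @ [z])"

lemma trail_via_Nil [simp]: "trail_via E x [] z \<longleftrightarrow> E x z"
  by (simp add: trail_via_def)

lemma trail_via_Cons [simp]: "trail_via E x (y # P) z \<longleftrightarrow> E x y \<and> trail_via E y P z"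
  by (simp add: trail_via_def)

lemma trail_via_append [simp]:
  "trail_via E x (P @ y # Q) z \<longleftrightarrow> trail_via E x P y \<and> trail_via E y Q z"
  by (induction P arbitrary: x) auto

lemma successively_trail_via:
  "successively E (x # P @ z # R) \<longleftrightarrow> trail_via E x P z \<and> successively E (z # R)"
  by (induction P arbitrary: x) (auto simp: trail_via_def)

definition cyc :: "('a \<Rightarrow> 'a \<Rightarrow> bool) \<Rightarrow> 'a list \<Rightarrow> bool" where
  "cyc E xs \<longleftrightarrow> distinct xs \<and> 3 \<le> length xs \<and> successively E (xs @ [hd xs])"

definition chordless :: "('a \<Rightarrow> 'a \<Rightarrow> bool) \<Rightarrow> 'a list \<Rightarrow> bool" where
  "chordless E xs \<longleftrightarrow> (\<forall>i < length xs. \<forall>j < length xs. E (xs ! i) (xs ! j) \<longrightarrow>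
     j = Suc i mod length xs \<or> i = Suc j mod length xs)"

text \<open>The last assumption expresses minimum degree at least 3.\<close>

locale two_conn =
  fixes V :: "'a set" and E :: "'a \<Rightarrow> 'a \<Rightarrow> bool"
  assumes sym: "E x y \<Longrightarrow> E y x"
    and irrefl: "\<not> E x x"
    and adj_V: "E x y \<Longrightarrow> x \<in> V"
    and conn: "\<lbrakk>x \<in> V; y \<in> V; z \<in> V; y \<noteq> x; z \<noteq> x\<rbrakk> \<Longrightarrow> (\<lambda>u v. E u v \<and> u \<noteq> x \<and> v \<noteq> x)\<^sup>*\<^sup>* y z"
    and deg3: "x \<in> V \<Longrightarrow> \<exists>y. E x y \<and> y \<noteq> a \<and> y \<noteq> b"
begin

lemma E_comm: "E x y \<longleftrightarrow> E y x"
  using sym by blast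

lemma adj_neq: "E x y \<Longrightarrow> x \<noteq> y"
  using irrefl by blast

lemma trail_via_rev [simp]: "trail_via E z (rev P) x \<longleftrightarrow> trail_via E x P z"
  by (induction P arbitrary: x) (auto simp: E_comm)

text \<open>A walk from \<open>y\<close> to a vertex of \<open>S\<close> that avoids
  \<open>x\<close> exists by \<open>conn\<close>. Stopping it at its first vertex in
  \<open>S\<close> and cutting out its loops leaves a path. The induction runs backwards from the
  end of the walk, so both repairs are made one edge at a time.\<close>

lemma path_to_set:
  assumes "x \<in> V" "y \<in> V" "y \<notin> S" "y \<noteq> x" "S \<subseteq> V" "S - {x} \<noteq> {}"
  obtains P z where "z \<in> S" "z \<noteq> x" "trail_via E y P z" "distinct (y # P)"
    "set P \<inter> S = {}" "x \<notin> set P"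
proof -
  obtain s where s: "s \<in> S" "s \<noteq> x" using assms by blast
  then have "(\<lambda>u v. E u v \<and> u \<noteq> x \<and> v \<noteq> x)\<^sup>*\<^sup>* y s"
    using conn assms by blast
  then have "y \<noteq> x \<longrightarrow> y \<notin> S \<longrightarrow> (\<exists>P z. z \<in> S \<and> z \<noteq> x \<and> trail_via E y P z \<and> distinct (y # P)
     \<and> set P \<inter> S = {} \<and> x \<notin> set P)"
  proof (induction rule: converse_rtranclp_induct)
    case base
    then show ?case using s by blast
  next
    case (step u v)
    show ?case
    proof (intro impI)
      assume u: "u \<noteq> x" "u \<notin> S"
      show "\<exists>P z. z \<in> S \<and> z \<noteq> x \<and> trail_via E u P z \<and> distinct (u # P)
     \<and> set P \<inter> S = {} \<and> x \<notin> set P"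
      proof (cases "v \<in> S")
        case True
        with step.hyps show ?thesis by (intro exI[of _ "[]"] exI[of _ v]) auto
      next
        case False
        with step obtain P z where P: "z \<in> S" "z \<noteq> x" "trail_via E v P z" "distinct (v # P)"
          "set P \<inter> S = {}" "x \<notin> set P" by blast
        \<comment> \<open>If \<open>u\<close> already lies on the path found for \<open>v\<close>,
          the part of that path after \<open>u\<close> suffices.\<close>
        consider "u = v" | A B where "P = A @ u # B" | "u \<notin> set (v # P)"
          by (auto dest: split_list)
        then show ?thesis
        proof cases
          case 1
          with P show ?thesis by blast
        next
          case 2
          with P show ?thesis by (intro exI[of _ B] exI[of _ z]) auto
        next
          case 3
          with P step.hyps False show ?thesis by (intro exI[of _ "v # P"] exI[of _ z]) auto
        qed
      qed
    qed
  qed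
  with assms that show ?thesis by blast
qed

text \<open>Leave \<open>S\<close> along the given edge and return by a path that avoids
  \<open>x\<close>. The last clause serves to show that an ear has interior vertices: an empty ear
  ends at \<open>y\<close>, so it suffices to choose \<open>y\<close> different from the end in
  question.\<close>

lemma ear:
  assumes "x \<in> S" "S \<subseteq> V" "S - {x} \<noteq> {}" "E x y"
  obtains P z where "z \<in> S" "z \<noteq> x" "trail_via E x P z" "distinct P"
    "set P \<inter> S = {}" "P = [] \<Longrightarrow> z = y"
proof (cases "y \<in> S")
  case True
  then show ?thesis using that[of y "[]"] assms adj_neq by auto
next
  case False
  have "x \<in> V" "y \<in> V" "y \<noteq> x" using assms adj_V sym adj_neq by blast+
  then obtain P z where "z \<in> S" "z \<noteq> x" "trail_via E y P z" "distinct (y # P)"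
    "set P \<inter> S = {}" "x \<notin> set P"
    using path_to_set[OF _ _ False _ assms(2,3)] by metis
  with False assms show ?thesis by (intro that[of z "y # P"]) auto
qed

text \<open>An edge off \<open>S\<close> can be assumed to hang on \<open>S\<close> by a vertex
  \<open>a\<close> next to \<open>z\<close>. Leaving from the other end \<open>b\<close> without
  using \<open>a\<close> gives the ear, unless the path comes back to \<open>z\<close> itself; then
  a second path, from \<open>a\<close> and avoiding \<open>z\<close>, is combined with the
  first.\<close>

lemma long_ear:
  assumes "S \<subseteq> V" "E u v" "u \<notin> S" "v \<notin> S" "s \<in> S" "s' \<in> S" "s \<noteq> s'"
  obtains P z w where "z \<in> S" "w \<in> S" "z \<noteq> w" "trail_via E z P w" "distinct P"
    "set P \<inter> S = {}" "2 \<le> length P"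
proof -
  have V: "u \<in> V" "v \<in> V" using assms adj_V sym by blast+
  \<comment> \<open>A path from \<open>u\<close> to \<open>S\<close> is followed to its end; its
    last two vertices off \<open>S\<close> are taken, with \<open>v\<close> as the second one when
    \<open>u\<close> is the only vertex of the path off \<open>S\<close>.\<close>
  obtain a b z where z: "z \<in> S" "E z a" "E a b" "a \<notin> S" "b \<notin> S"
  proof -
    obtain P z where P: "z \<in> S" "trail_via E u P z" "set P \<inter> S = {}"
    proof -
      have s: "s \<in> V" "u \<noteq> s" "S - {s} \<noteq> {}" using assms by auto
      show ?thesis using path_to_set[OF s(1) V(1) assms(3) s(2) assms(1) s(3)] that by metis
    qed
    show ?thesis
    proof (cases P rule: rev_cases)
      case Nil
      then show ?thesis using that[of z u v] P assms by (simp add: E_comm)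
    next
      case (snoc Q c)
      then have c: "c \<notin> S" "E z c" using P by (auto simp: E_comm)
      show ?thesis
      proof (cases Q rule: rev_cases)
        case Nil
        with snoc P c assms show ?thesis by (intro that[of z c u]) (auto simp: E_comm)
      next
        case (snoc R d)
        with \<open>P = Q @ [c]\<close> P c show ?thesis by (intro that[of z c d]) (auto simp: E_comm)
      qed
    qed
  qed
  have V: "a \<in> V" "b \<in> V" "z \<in> V" using z adj_V sym by blast+
  have ne: "S - {a} \<noteq> {}" "b \<noteq> a" using z assms adj_neq by auto
  obtain R w where R: "w \<in> S" "trail_via E b R w" "distinct (b # R)" "set R \<inter> S = {}" "a \<notin> set R"
    using path_to_set[OF V(1,2) z(5) ne(2) assms(1) ne(1)] by metis
  show ?thesis
  proof (cases "w = z")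
    case False
    with R z ne show ?thesis by (intro that[of z w "a # b # R"]) auto
  next
    \<comment> \<open>Here \<open>z, a, b, R\<close> closes to a cycle that meets \<open>S\<close>
      in \<open>z\<close> only, so an exit \<open>Q\<close> from \<open>a\<close> to another vertex
      of \<open>S\<close> is needed.\<close>
    case True
    have "S - {z} \<noteq> {}" "a \<noteq> z" using assms z by auto
    then obtain Q y where Q: "y \<in> S" "y \<noteq> z" "trail_via E a Q y" "distinct (a # Q)"
      "set Q \<inter> S = {}" "z \<notin> set Q"
      using path_to_set[OF V(3,1) z(4) _ assms(1)] by metis
    show ?thesis
    proof (cases "set Q \<inter> set (b # R) = {}")
      case True
      \<comment> \<open>\<open>Q\<close> misses the cycle: run around the cycle from
        \<open>z\<close> the long way to \<open>a\<close>, then exit along \<open>Q\<close>.\<close>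
      with R z Q \<open>w = z\<close> ne show ?thesis
        by (intro that[of z y "rev (b # R) @ a # Q"]) (auto simp: E_comm simp del: rev.simps)
    next
      case False
      \<comment> \<open>\<open>t\<close> is the last vertex of \<open>Q\<close> on the cycle: run
        from \<open>z\<close> through \<open>a\<close> along the cycle to \<open>t\<close> and exit
        along the rest of \<open>Q\<close>, which no longer meets it.\<close>
      then obtain Q1 t Q2 where Q12: "Q = Q1 @ t # Q2" "t \<in> set (b # R)" "\<forall>q\<in>set Q2. q \<notin> set (b # R)"
        using split_list_last_prop[of Q "\<lambda>t. t \<in> set (b # R)"] by blast
      obtain A B where AB: "b # R = A @ t # B"
        using Q12(2) by (meson split_list)
      have "trail_via E a (b # R) w" using R z by simp
      then have "trail_via E a A t" unfolding AB by simp
      moreover have "distinct (b # R)" "set (b # R) \<inter> S = {}" "a \<notin> set (b # R)" using R z ne by auto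
      ultimately show ?thesis using Q12 Q z unfolding AB
        by (intro that[of z y "a # A @ t # Q2"]) auto
    qed
  qed
qed

definition circ_le :: "nat \<Rightarrow> bool" where
  "circ_le n \<longleftrightarrow> (\<forall>xs. cyc E xs \<longrightarrow> length xs \<le> n)"

lemma circ_leD: "circ_le n \<Longrightarrow> cyc E xs \<Longrightarrow> length xs \<le> n"
  by (simp add: circ_le_def)

lemma trail_via_V: "trail_via E x P z \<Longrightarrow> set P \<subseteq> V"
  by (induction P arbitrary: x) (auto simp: adj_V[OF sym])

section \<open>Theta graphs\<close>

text \<open>
  The theta graph has branch vertices \<open>p\<close>, \<open>q\<close> and branches with interiors \<open>s, t\<close>, \<open>c, d\<close> and \<open>Q\<close>.
\<close>

lemma theta_chord:
  assumes B: "circ_le n" "n = length Q + 4"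
    and len: "2 \<le> length Q" "length Q \<le> 3"
    and dist: "distinct ([p, q, s, t, c, d] @ Q)"
    and adj: "E p s" "E s t" "E t q" "E p c" "E c d" "E d q" "trail_via E p Q q"
    and "\<not> E s q"
  shows "\<exists>w. E s w \<and> E w q \<and> w \<notin> {p, q, s, t, c, d} \<union> set Q"
proof -
  note bound = circ_leD[OF B(1)]
  have "s \<in> V" using adj adj_V by blast
  \<comment> \<open>The third neighbour of \<open>s\<close> starts an ear of the whole theta
    graph.\<close>
  then obtain y where y: "E s y" "y \<noteq> p" "y \<noteq> t" using deg3 by blast
  then have "y \<noteq> q" using \<open>\<not> E s q\<close> by blast
  let ?S = "{p, q, s, t, c, d} \<union> set Q"
  have "?S \<subseteq> V" using adj adj_V sym trail_via_V by auto
  moreover have "?S - {s} \<noteq> {}" "s \<in> ?S" using dist by auto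
  ultimately obtain P z where z: "z \<in> ?S" "z \<noteq> s" and P: "trail_via E s P z" "distinct P"
    "set P \<inter> ?S = {}" "P = [] \<Longrightarrow> z = y"
    using ear[OF _ _ _ y(1), of ?S] by metis
  note facts = dist adj P len B(2)
  \<comment> \<open>The cycle through \<open>s, t\<close> and \<open>Q\<close> already has length
    \<open>n\<close>. An ear ending anywhere but at \<open>q\<close> closes a longer cycle, and one
    ending at \<open>q\<close> has room for exactly one interior vertex, the required
    \<open>w\<close>.\<close>
  consider "z = p" | "z = q" | "z = t" | "z = c" | "z = d" | "z \<in> set Q" using z by blast
  then show ?thesis
  proof cases
    case 1
    with P y have "0 < length P" by auto
    then show ?thesis using 1 facts bound[of "p # rev P @ [s, t, q] @ rev Q"]
      by (auto simp: cyc_def successively_trail_via E_comm)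
  next
    case 2
    with P y \<open>y \<noteq> q\<close> have "0 < length P" by auto
    moreover have "length P \<le> 1" using 2 facts bound[of "p # s # P @ q # rev Q"]
      by (auto simp: cyc_def successively_trail_via E_comm)
    ultimately obtain w where "P = [w]" by (cases P) auto
    then show ?thesis using 2 P by auto
  next
    case 3
    with P y have "0 < length P" by auto
    then show ?thesis using 3 facts bound[of "p # s # P @ [t, q] @ rev Q"]
      by (auto simp: cyc_def successively_trail_via E_comm)
  next
    case 4
    then show ?thesis using facts bound[of "p # s # P @ [c, d, q] @ rev Q"]
      by (auto simp: cyc_def successively_trail_via E_comm)
  next
    case 5
    then show ?thesis using facts bound[of "s # P @ [d, c, p] @ Q @ [q, t]"]
      by (auto simp: cyc_def successively_trail_via E_comm)
  next
    case 6
    then obtain A B where Q: "Q = A @ z # B" by (meson split_list)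
    show ?thesis
    proof (cases A)
      case Nil
      then show ?thesis using facts Q bound[of "s # P @ z # B @ [q, d, c, p]"]
        by (auto simp: cyc_def successively_trail_via E_comm)
    next
      case Cons
      \<comment> \<open>Of \<open>Q\<close> this cycle contains only \<open>z\<close> and the
        nonempty \<open>A\<close>, so its length is at least 8; this exceeds \<open>n\<close>
        because \<open>length Q \<le> 3\<close>.\<close>
      then show ?thesis using facts Q bound[of "s # P @ z # rev A @ [p, c, d, q, t]"]
        by (auto simp: cyc_def successively_trail_via E_comm)
    qed
  qed
qed

text \<open>By \<open>theta_chord\<close> from either end, \<open>s\<close> is joined to
  \<open>q\<close> and \<open>t\<close> to \<open>p\<close> through outside vertices. Replacing the
  branch \<open>s, t\<close> by a route through these vertices lengthens its cycle with
  \<open>Q\<close> beyond \<open>n\<close>, whether or not they coincide.\<close>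

lemma no_theta:
  assumes B: "circ_le n" "n = length Q + 4"
    and len: "2 \<le> length Q" "length Q \<le> 3"
    and dist: "distinct ([p, q, s, t, c, d] @ Q)"
    and adj: "E p s" "E s t" "E t q" "E p c" "E c d" "E d q" "trail_via E p Q q"
    and "\<not> E s q" "\<not> E t p"
  shows False
proof -
  note bound = circ_leD[OF B(1)]
  obtain w where w: "E s w" "E w q" "w \<notin> {p, q, s, t, c, d} \<union> set Q"
    using theta_chord[of n Q p q s t c d] assms by blast
  \<comment> \<open>The same theta graph with all branches read from \<open>q\<close> to
    \<open>p\<close>.\<close>
  obtain w' where w': "E t w'" "E w' p" "w' \<notin> {p, q, s, t, c, d} \<union> set Q"
    using theta_chord[of n "rev Q" q p t s d c] assms by (auto simp: E_comm)
  show False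
  proof (cases "w = w'")
    case True
    then show False using B(2) dist adj w w' bound[of "[p, s, w, t, q] @ rev Q"]
      by (auto simp: cyc_def successively_trail_via E_comm)
  next
    case False
    then show False using B(2) dist adj w w' bound[of "[p, w', t, s, w, q] @ rev Q"]
      by (auto simp: cyc_def successively_trail_via E_comm)
  qed
qed

text \<open>Both \<open>x\<close> and \<open>w\<close> join \<open>p\<close> to \<open>y\<close>, so
  the third branch may be routed through either. An ear leaving \<open>x\<close>, combined with a
  suitable routing, closes a cycle of length at least 8 wherever it ends.\<close>

lemma no_theta_side:
  assumes B: "circ_le 7"
    and dist: "distinct [p, q, a, b, c, d, x, y, z, w]"
    and adj: "E p a" "E a b" "E b q" "E p c" "E c d" "E d q" "E p x" "E x y" "E y z" "E z q"
      "E p w" "E w y"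
    and nadj: "\<not> E x z" "\<not> E x q"
  shows False
proof -
  note bound = circ_leD[OF B]
  have "x \<in> V" using adj adj_V by blast
  then obtain u where u: "E x u" "u \<noteq> p" "u \<noteq> y" using deg3 by blast
  then have ne: "u \<noteq> q" "u \<noteq> z" using nadj by blast+
  let ?S = "{p, q, a, b, c, d, x, y, z, w}"
  have "?S \<subseteq> V" using adj adj_V sym by auto
  moreover have "?S - {x} \<noteq> {}" "x \<in> ?S" using dist by auto
  ultimately obtain P v where v: "v \<in> ?S" "v \<noteq> x" and P: "trail_via E x P v" "distinct P"
    "set P \<inter> ?S = {}" "P = [] \<Longrightarrow> v = u"
    using ear[OF _ _ _ u(1), of ?S] by metis
  \<comment> \<open>An empty ear would end at \<open>u\<close>, which is none of these three
    vertices.\<close>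
  have pos: "v \<in> {p, q, y} \<Longrightarrow> 0 < length P" using P u ne by auto
  note facts = dist adj P(1-3)
  consider "v = p" | "v = q" | "v = a" | "v = b" | "v = c" | "v = d" | "v = y" | "v = z" | "v = w"
    using v by blast
  then show False
  proof cases
    case 1
    then show ?thesis using 1 pos facts bound[of "p # rev P @ [x, y, z, q, b, a]"]
      by (auto simp: cyc_def successively_trail_via E_comm)
  next
    case 2
    then show ?thesis using 2 pos facts bound[of "p # w # y # x # P @ [q, b, a]"]
      by (auto simp: cyc_def successively_trail_via E_comm)
  next
    case 3
    then show ?thesis using facts bound[of "x # P @ [a, b, q, d, c, p, w, y]"]
      by (auto simp: cyc_def successively_trail_via E_comm)
  next
    case 4
    then show ?thesis using facts bound[of "x # P @ [b, a, p, c, d, q, z, y]"]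
      by (auto simp: cyc_def successively_trail_via E_comm)
  next
    case 5
    then show ?thesis using facts bound[of "x # P @ [c, d, q, b, a, p, w, y]"]
      by (auto simp: cyc_def successively_trail_via E_comm)
  next
    case 6
    then show ?thesis using facts bound[of "x # P @ [d, c, p, a, b, q, z, y]"]
      by (auto simp: cyc_def successively_trail_via E_comm)
  next
    case 7
    then show ?thesis using 7 pos facts bound[of "p # x # P @ [y, z, q, b, a]"]
      by (auto simp: cyc_def successively_trail_via E_comm)
  next
    case 8
    then show ?thesis using facts bound[of "p # w # y # x # P @ [z, q, b, a]"]
      by (auto simp: cyc_def successively_trail_via E_comm)
  next
    case 9
    then show ?thesis using facts bound[of "p # x # P @ [w, y, z, q, b, a]"]
      by (auto simp: cyc_def successively_trail_via E_comm)
  qed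
qed

text \<open>An ear leaving the middle vertex \<open>y\<close> of the longest branch closes a cycle
  of length at least 8, unless it reaches \<open>p\<close> or \<open>q\<close> through a single
  vertex. That vertex bypasses \<open>x\<close> or \<open>z\<close>, which is the situation of
  \<open>no_theta_side\<close>.\<close>

lemma no_theta_middle:
  assumes B: "circ_le 7"
    and dist: "distinct [p, q, a, b, c, d, x, y, z]"
    and adj: "E p a" "E a b" "E b q" "E p c" "E c d" "E d q" "E p x" "E x y" "E y z" "E z q"
    and nadj: "\<not> E x z" "\<not> E x q" "\<not> E y p" "\<not> E y q" "\<not> E z p"
  shows False
proof -
  note bound = circ_leD[OF B]
  have "y \<in> V" using adj adj_V by blast
  then obtain u where u: "E y u" "u \<noteq> x" "u \<noteq> z" using deg3 by blast
  then have ne: "u \<noteq> p" "u \<noteq> q" using nadj by blast+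
  let ?S = "{p, q, a, b, c, d, x, y, z}"
  have "?S \<subseteq> V" using adj adj_V sym by auto
  moreover have "?S - {y} \<noteq> {}" "y \<in> ?S" using dist by auto
  ultimately obtain P v where v: "v \<in> ?S" "v \<noteq> y" and P: "trail_via E y P v" "distinct P"
    "set P \<inter> ?S = {}" "P = [] \<Longrightarrow> v = u"
    using ear[OF _ _ _ u(1), of ?S] by metis
  have pos: "v \<in> {p, q, x, z} \<Longrightarrow> 0 < length P" using P u ne by auto
  note facts = dist adj P(1-3)
  consider "v = p" | "v = q" | "v = a" | "v = b" | "v = c" | "v = d" | "v = x" | "v = z"
    using v by blast
  then show False
  proof cases
    case 1
    then have "length P \<le> 1" using 1 pos facts bound[of "p # rev P @ [y, z, q, b, a]"]
      by (auto simp: cyc_def successively_trail_via E_comm)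
    with 1 pos obtain w where "P = [w]" by (cases P) auto
    then show ?thesis
      using no_theta_side[OF B, of p q a b c d x y z w] 1 facts nadj by (auto simp: E_comm)
  next
    case 2
    then have "length P \<le> 1" using 2 pos facts bound[of "q # rev P @ [y, x, p, a, b]"]
      by (auto simp: cyc_def successively_trail_via E_comm)
    with 2 pos obtain w where "P = [w]" by (cases P) auto
    then show ?thesis
      using no_theta_side[OF B, of q p b a d c z y x w] 2 facts nadj by (auto simp: E_comm)
  next
    case 3
    then show ?thesis using facts bound[of "y # P @ [a, b, q, d, c, p, x]"]
      by (auto simp: cyc_def successively_trail_via E_comm)
  next
    case 4
    then show ?thesis using facts bound[of "y # P @ [b, a, p, c, d, q, z]"]
      by (auto simp: cyc_def successively_trail_via E_comm)
  next
    case 5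
    then show ?thesis using facts bound[of "y # P @ [c, d, q, b, a, p, x]"]
      by (auto simp: cyc_def successively_trail_via E_comm)
  next
    case 6
    then show ?thesis using facts bound[of "y # P @ [d, c, p, a, b, q, z]"]
      by (auto simp: cyc_def successively_trail_via E_comm)
  next
    case 7
    then show ?thesis using 7 pos facts bound[of "p # x # rev P @ [y, z, q, b, a]"]
      by (auto simp: cyc_def successively_trail_via E_comm)
  next
    case 8
    then show ?thesis using 8 pos facts bound[of "p # x # y # P @ [z, q, b, a]"]
      by (auto simp: cyc_def successively_trail_via E_comm)
  qed
qed

section \<open>Induced cycles of length 6\<close>

definition hexagon :: "'a \<Rightarrow> 'a \<Rightarrow> 'a \<Rightarrow> 'a \<Rightarrow> 'a \<Rightarrow> 'a \<Rightarrow> bool" where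
  "hexagon x0 x1 x2 x3 x4 x5 \<longleftrightarrow> distinct [x0, x1, x2, x3, x4, x5] \<and>
    E x0 x1 \<and> E x1 x2 \<and> E x2 x3 \<and> E x3 x4 \<and> E x4 x5 \<and> E x5 x0 \<and>
    \<not> E x0 x2 \<and> \<not> E x1 x3 \<and> \<not> E x2 x4 \<and> \<not> E x3 x5 \<and> \<not> E x4 x0 \<and> \<not> E x5 x1 \<and>
    \<not> E x0 x3 \<and> \<not> E x1 x4 \<and> \<not> E x2 x5"

text \<open>Rotation and reflection generate all symmetries of the hexagon, so later arguments may
  start at a fixed vertex and direction.\<close>

lemma hexagon_rotate: "hexagon x0 x1 x2 x3 x4 x5 \<Longrightarrow> hexagon x1 x2 x3 x4 x5 x0"
  and hexagon_reflect: "hexagon x0 x1 x2 x3 x4 x5 \<Longrightarrow> hexagon x0 x5 x4 x3 x2 x1"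
  unfolding hexagon_def by (auto simp: E_comm)

lemma hexagon_outer_nbr:
  assumes "hexagon x0 x1 x2 x3 x4 x5"
  shows "\<exists>y. E x0 y \<and> y \<notin> {x0, x1, x2, x3, x4, x5}"
proof -
  have "x0 \<in> V" using assms adj_V by (auto simp: hexagon_def)
  then obtain y where "E x0 y" "y \<noteq> x1" "y \<noteq> x5" using deg3 by blast
  moreover have "\<not> E x0 x2" "\<not> E x0 x3" "\<not> E x0 x4" "\<not> E x0 x0"
    using assms irrefl sym by (auto simp: hexagon_def)
  ultimately show ?thesis by blast
qed

text \<open>The bound leaves two interior vertices \<open>a, b\<close>. An ear leaving
  \<open>x1\<close> closes a cycle of length at least 8, unless it returns to \<open>x0\<close> or
  \<open>x2\<close> through a single \<open>w\<close>. Then \<open>x0\<close> and \<open>x2\<close>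
  are the branch vertices of a theta graph with branches \<open>a, b\<close>, the pair
  \<open>x1, w\<close> in some order, and \<open>x5, x4, x3\<close>; its required non-edges are
  missing chords of the hexagon, so \<open>no_theta_middle\<close> applies.\<close>

lemma hexagon_ear_2:
  assumes B: "circ_le 7"
    and hex: "hexagon x0 x1 x2 x3 x4 x5"
    and Q: "trail_via E x0 Q x2" "distinct Q" "set Q \<inter> {x0, x1, x2, x3, x4, x5} = {}"
      "2 \<le> length Q"
  shows False
proof -
  note bound = circ_leD[OF B]
  have "length Q \<le> 2" using hex Q bound[of "x0 # Q @ [x2, x3, x4, x5]"]
    by (auto simp: hexagon_def cyc_def successively_trail_via E_comm)
  with Q(4) obtain a b where ab: "Q = [a, b]" by (auto simp: Suc_le_length_iff numeral_2_eq_2)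
  obtain y where y: "E x1 y" "y \<notin> {x0, x1, x2, x3, x4, x5}"
    using hexagon_outer_nbr[OF hexagon_rotate[OF hex]] by blast
  have dist: "distinct [x0, x1, x2, x3, x4, x5, a, b]"
    and adj: "E x0 x1" "E x1 x2" "E x2 x3" "E x3 x4" "E x4 x5" "E x5 x0" "E x0 a" "E a b" "E b x2"
    using hex Q ab unfolding hexagon_def by auto
  let ?S = "{x0, x1, x2, x3, x4, x5, a, b}"
  have "?S \<subseteq> V" using adj adj_V sym by auto
  moreover have "?S - {x1} \<noteq> {}" "x1 \<in> ?S" using dist by auto
  ultimately obtain P v where v: "v \<in> ?S" "v \<noteq> x1" and P: "trail_via E x1 P v" "distinct P"
    "set P \<inter> ?S = {}" "P = [] \<Longrightarrow> v = y"
    using ear[OF _ _ _ y(1), of ?S] by metis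
  have pos: "v \<in> {x0, x1, x2, x3, x4, x5} \<Longrightarrow> 0 < length P" using P y by auto
  note facts = dist adj P(1-3)
  consider "v = x0" | "v = x2" | "v = x3" | "v = x4" | "v = x5" | "v = a" | "v = b"
    using v by blast
  then show False
  proof cases
    case 1
    then have "length P \<le> 1" using 1 pos facts bound[of "x1 # P @ [x0, x5, x4, x3, x2]"]
      by (auto simp: cyc_def successively_trail_via E_comm)
    with 1 pos obtain w where "P = [w]" by (cases P) auto
    then show ?thesis
      using no_theta_middle[OF B, of x0 x2 a b w x1 x5 x4 x3] 1 facts hex
      by (auto simp: E_comm hexagon_def)
  next
    case 2
    then have "length P \<le> 1" using 2 pos facts bound[of "x1 # P @ [x2, x3, x4, x5, x0]"]
      by (auto simp: cyc_def successively_trail_via E_comm)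
    with 2 pos obtain w where "P = [w]" by (cases P) auto
    then show ?thesis
      using no_theta_middle[OF B, of x0 x2 a b x1 w x5 x4 x3] 2 facts hex
      by (auto simp: E_comm hexagon_def)
  next
    case 3
    then show ?thesis using 3 pos facts bound[of "x1 # P @ [x3, x4, x5, x0, a, b, x2]"]
      by (auto simp: cyc_def successively_trail_via E_comm)
  next
    case 4
    then show ?thesis using 4 pos facts bound[of "x1 # P @ [x4, x5, x0, a, b, x2]"]
      by (auto simp: cyc_def successively_trail_via E_comm)
  next
    case 5
    then show ?thesis using 5 pos facts bound[of "x1 # P @ [x5, x4, x3, x2, b, a, x0]"]
      by (auto simp: cyc_def successively_trail_via E_comm)
  next
    case 6
    then show ?thesis using facts bound[of "x1 # P @ [a, b, x2, x3, x4, x5, x0]"]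
      by (auto simp: cyc_def successively_trail_via E_comm)
  next
    case 7
    then show ?thesis using facts bound[of "x1 # P @ [b, a, x0, x5, x4, x3, x2]"]
      by (auto simp: cyc_def successively_trail_via E_comm)
  qed
qed

text \<open>Of the ears leaving \<open>x1\<close>, those that close no cycle of length at least 8
  end at \<open>x0\<close>, \<open>x2\<close>, \<open>x3\<close> or \<open>a\<close>. A return to
  \<open>x0\<close> or \<open>x2\<close> through one vertex makes a branch of three vertices between
  \<open>x0\<close> and \<open>x3\<close>, excluded by \<open>no_theta\<close>; an end at
  \<open>a\<close> extends through \<open>b\<close> to a long ear from \<open>x1\<close> to
  \<open>x3\<close>, excluded by \<open>hexagon_ear_2\<close>. What remains is an ear to
  \<open>x3\<close> with one interior vertex.\<close>

lemma hexagon_ear_3_chord: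
  assumes B: "circ_le 7"
    and hex: "hexagon x0 x1 x2 x3 x4 x5"
    and ab: "E x0 a" "E a b" "E b x3" "distinct [x0, x1, x2, x3, x4, x5, a, b]"
  shows "\<exists>w. E x1 w \<and> E w x3 \<and> w \<notin> {x0, x1, x2, x3, x4, x5, a, b}"
proof -
  note bound = circ_leD[OF B]
  obtain y where y: "E x1 y" "y \<notin> {x0, x1, x2, x3, x4, x5}"
    using hexagon_outer_nbr[OF hexagon_rotate[OF hex]] by blast
  have adj: "E x0 x1" "E x1 x2" "E x2 x3" "E x3 x4" "E x4 x5" "E x5 x0"
    and nadj: "\<not> E x5 x3" "\<not> E x4 x0" "\<not> E x3 x5" "\<not> E x0 x4"
    using hex sym unfolding hexagon_def by auto
  let ?S = "{x0, x1, x2, x3, x4, x5, a, b}"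
  have "?S \<subseteq> V" using adj ab adj_V sym by auto
  moreover have "?S - {x1} \<noteq> {}" "x1 \<in> ?S" using ab by auto
  ultimately obtain P v where v: "v \<in> ?S" "v \<noteq> x1" and P: "trail_via E x1 P v" "distinct P"
    "set P \<inter> ?S = {}" "P = [] \<Longrightarrow> v = y"
    using ear[OF _ _ _ y(1), of ?S] by metis
  have pos: "v \<in> {x0, x1, x2, x3, x4, x5} \<Longrightarrow> 0 < length P" using P y by auto
  note facts = ab adj P(1-3)
  consider "v = x0" | "v = x2" | "v = x3" | "v = x4" | "v = x5" | "v = a" | "v = b"
    using v by blast
  then show ?thesis
  proof cases
    case 1
    then have "length P \<le> 1" using 1 pos facts bound[of "x1 # P @ [x0, x5, x4, x3, x2]"]
      by (auto simp: cyc_def successively_trail_via E_comm)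
    with 1 pos obtain w where "P = [w]" by (cases P) auto
    then show ?thesis
      using no_theta[OF B, of "[w, x1, x2]" x0 x3 x5 x4 a b] 1 facts nadj by (auto simp: E_comm)
  next
    case 2
    then have "length P \<le> 1" using 2 pos facts bound[of "x1 # P @ [x2, x3, x4, x5, x0]"]
      by (auto simp: cyc_def successively_trail_via E_comm)
    with 2 pos obtain w where "P = [w]" by (cases P) auto
    then show ?thesis
      using no_theta[OF B, of "[x1, w, x2]" x0 x3 x5 x4 a b] 2 facts nadj by (auto simp: E_comm)
  next
    case 3
    have "\<not> 2 \<le> length P"
      using hexagon_ear_2[OF B hexagon_rotate[OF hex], of P] P 3 by auto
    then have "length P \<le> 1" by simp
    with 3 pos obtain w where "P = [w]" by (cases P) auto
    then show ?thesis using P 3 by auto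
  next
    case 4
    then show ?thesis using 4 pos facts bound[of "x1 # P @ [x4, x5, x0, a, b, x3, x2]"]
      by (auto simp: cyc_def successively_trail_via E_comm)
  next
    case 5
    then show ?thesis using 5 pos facts bound[of "x1 # P @ [x5, x0, a, b, x3, x2]"]
      by (auto simp: cyc_def successively_trail_via E_comm)
  next
    case 6
    then show ?thesis
      using hexagon_ear_2[OF B hexagon_rotate[OF hex], of "P @ [a, b]"] facts by auto
  next
    case 7
    then show ?thesis using facts bound[of "x1 # P @ [b, a, x0, x5, x4, x3, x2]"]
      by (auto simp: cyc_def successively_trail_via E_comm)
  qed
qed

text \<open>The ear has at most three interior vertices. Three give a theta graph with both halves
  of the hexagon. With two, \<open>hexagon_ear_3_chord\<close> attaches outside vertices to
  \<open>x1, x3\<close> and to \<open>x2, x0\<close>: if they coincide, a branch of three vertices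
  arises again, otherwise a cycle of length 8.\<close>

lemma hexagon_ear_3:
  assumes B: "circ_le 7"
    and hex: "hexagon x0 x1 x2 x3 x4 x5"
    and Q: "trail_via E x0 Q x3" "distinct Q" "set Q \<inter> {x0, x1, x2, x3, x4, x5} = {}"
      "2 \<le> length Q"
  shows False
proof -
  note bound = circ_leD[OF B]
  have dist: "distinct [x0, x1, x2, x3, x4, x5]"
    and adj: "E x0 x1" "E x1 x2" "E x2 x3" "E x3 x4" "E x4 x5" "E x5 x0"
    and nadj: "\<not> E x5 x3" "\<not> E x4 x0" "\<not> E x1 x3" "\<not> E x2 x0"
    using hex sym unfolding hexagon_def by auto
  have "length Q \<le> 3" using hex Q bound[of "x0 # Q @ [x3, x4, x5]"]
    by (auto simp: hexagon_def cyc_def successively_trail_via E_comm)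
  then consider "length Q = 3" | "length Q = 2" using Q by linarith
  then show False
  proof cases
    case 1
    then show ?thesis
      using no_theta[OF B, of Q x0 x3 x1 x2 x5 x4] Q dist adj nadj by (auto simp: E_comm)
  next
    case 2
    then obtain a b where ab: "Q = [a, b]" by (auto simp: length_Suc_conv numeral_2_eq_2)
    then have ab': "E x0 a" "E a b" "E b x3" "distinct [x0, x1, x2, x3, x4, x5, a, b]"
      using Q dist by auto
    obtain w where w: "E x1 w" "E w x3" "w \<notin> {x0, x1, x2, x3, x4, x5, a, b}"
      using hexagon_ear_3_chord[OF B hex ab'] by blast
    \<comment> \<open>The reflection exchanging \<open>x0\<close> with \<open>x3\<close> and
      \<open>x1\<close> with \<open>x2\<close>; it reverses the ear \<open>a, b\<close>.\<close>
    have hex': "hexagon x3 x2 x1 x0 x5 x4"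
      using hex unfolding hexagon_def by (auto simp: E_comm)
    obtain w' where w': "E x2 w'" "E w' x0" "w' \<notin> {x0, x1, x2, x3, x4, x5, a, b}"
      using hexagon_ear_3_chord[OF B hex', of b a] ab' sym by auto
    show ?thesis
    proof (cases "w = w'")
      case True
      then show ?thesis
        using no_theta[OF B, of "[x1, w, x2]" x0 x3 x5 x4 a b] ab' adj nadj w w'
        by (auto simp: E_comm)
    next
      case False
      then show ?thesis using ab' adj w w' bound[of "[x0, w', x2, x1, w, x3, b, a]"]
        by (auto simp: cyc_def E_comm)
    qed
  qed
qed

lemma hexagon_ear:
  assumes B: "circ_le 7"
    and hex: "hexagon x0 x1 x2 x3 x4 x5"
    and Q: "trail_via E x0 Q w" "distinct Q" "set Q \<inter> {x0, x1, x2, x3, x4, x5} = {}"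
      "2 \<le> length Q"
    and w: "w \<in> {x1, x2, x3, x4, x5}"
  shows False
proof -
  note bound = circ_leD[OF B]
  have hex': "hexagon x0 x5 x4 x3 x2 x1" by (rule hexagon_reflect[OF hex])
  consider "w = x1" | "w = x2" | "w = x3" | "w = x4" | "w = x5" using w by blast
  then show False
  proof cases
    case 1
    then show ?thesis using hex Q bound[of "x0 # Q @ [x1, x2, x3, x4, x5]"]
      by (auto simp: hexagon_def cyc_def successively_trail_via E_comm)
  next
    case 2
    then show ?thesis using hexagon_ear_2[OF B hex] Q by simp
  next
    case 3
    then show ?thesis using hexagon_ear_3[OF B hex] Q by simp
  next
    case 4
    then show ?thesis using hexagon_ear_2[OF B hex', of Q] Q by auto
  next
    case 5
    then show ?thesis using hex Q bound[of "x0 # Q @ [x5, x4, x3, x2, x1]"]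
      by (auto simp: hexagon_def cyc_def successively_trail_via E_comm)
  qed
qed

text \<open>An edge off the hexagon would give a long ear by \<open>long_ear\<close>, and
  \<open>hexagon_ear\<close>, after a rotation to its starting vertex, excludes every such
  ear.\<close>

lemma hexagon_outer_independent:
  assumes B: "circ_le 7"
    and hex: "hexagon x0 x1 x2 x3 x4 x5"
    and uv: "E u v" "u \<notin> {x0, x1, x2, x3, x4, x5}"
  shows "v \<in> {x0, x1, x2, x3, x4, x5}"
proof (rule ccontr)
  let ?S = "{x0, x1, x2, x3, x4, x5}"
  assume "v \<notin> ?S"
  moreover have "?S \<subseteq> V" "x0 \<noteq> x1" "x0 \<in> ?S" "x1 \<in> ?S"
    using hex adj_V by (auto simp: hexagon_def)
  ultimately obtain P z w where P: "z \<in> ?S" "w \<in> ?S" "z \<noteq> w" "trail_via E z P w" "distinct P"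
    "set P \<inter> ?S = {}" "2 \<le> length P"
    using long_ear[OF _ uv, of x0 x1] by metis
  note r1 = hexagon_rotate[OF hex]
  note r2 = hexagon_rotate[OF r1]
  note r3 = hexagon_rotate[OF r2]
  note r4 = hexagon_rotate[OF r3]
  note r5 = hexagon_rotate[OF r4]
  consider "z = x0" | "z = x1" | "z = x2" | "z = x3" | "z = x4" | "z = x5" using P by blast
  then show False
  proof cases
    case 1
    then show ?thesis using hexagon_ear[OF B hex, of P w] P by auto
  next
    case 2
    then show ?thesis using hexagon_ear[OF B r1, of P w] P by auto
  next
    case 3
    then show ?thesis using hexagon_ear[OF B r2, of P w] P by auto
  next
    case 4
    then show ?thesis using hexagon_ear[OF B r3, of P w] P by auto
  next
    case 5
    then show ?thesis using hexagon_ear[OF B r4, of P w] P by auto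
  next
    case 6
    then show ?thesis using hexagon_ear[OF B r5, of P w] P by auto
  qed
qed

section \<open>Inserting two outer vertices into a hexagon\<close>

text \<open>With \<open>v\<close> inserted between \<open>x0\<close> and \<open>x1\<close>,
  inserting \<open>w\<close> into a different edge would give a cycle of length 8.\<close>

lemma hexagon_gaps:
  assumes B: "circ_le 7"
    and "hexagon x0 x1 x2 x3 x4 x5"
    and "E v x0" "E v x1" "v \<noteq> w" "{v, w} \<inter> {x0, x1, x2, x3, x4, x5} = {}"
  shows "\<not> (E w x1 \<and> E w x2)" "\<not> (E w x2 \<and> E w x3)" "\<not> (E w x3 \<and> E w x4)"
    "\<not> (E w x4 \<and> E w x5)" "\<not> (E w x5 \<and> E w x0)"
proof -
  note bound = circ_leD[OF B]
  note facts = assms(2-)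
  show "\<not> (E w x1 \<and> E w x2)" using facts bound[of "[x0, v, x1, w, x2, x3, x4, x5]"]
    by (auto simp: hexagon_def cyc_def E_comm)
  show "\<not> (E w x2 \<and> E w x3)" using facts bound[of "[x0, v, x1, x2, w, x3, x4, x5]"]
    by (auto simp: hexagon_def cyc_def E_comm)
  show "\<not> (E w x3 \<and> E w x4)" using facts bound[of "[x0, v, x1, x2, x3, w, x4, x5]"]
    by (auto simp: hexagon_def cyc_def E_comm)
  show "\<not> (E w x4 \<and> E w x5)" using facts bound[of "[x0, v, x1, x2, x3, x4, w, x5]"]
    by (auto simp: hexagon_def cyc_def E_comm)
  show "\<not> (E w x5 \<and> E w x0)" using facts bound[of "[x0, v, x1, x2, x3, x4, x5, w]"]
    by (auto simp: hexagon_def cyc_def E_comm)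
qed

lemma hexagon_cross:
  assumes B: "circ_le 7"
    and "hexagon x0 x1 x2 x3 x4 x5"
    and "E v x0" "E v x2" "E w x1" "E w x3" "v \<noteq> w" "{v, w} \<inter> {x0, x1, x2, x3, x4, x5} = {}"
  shows False
  using assms(2-) circ_leD[OF B, of "[x0, v, x2, x1, w, x3, x4, x5]"]
  by (auto simp: hexagon_def cyc_def E_comm)

text \<open>By \<open>hexagon_gaps\<close> the outer vertices other than \<open>v\<close> have few
  possible neighbourhoods. Playing outer neighbours of \<open>x2\<close>, \<open>x3\<close> and
  \<open>x4\<close> against each other with \<open>hexagon_cross\<close> excludes all of
  them.\<close>

lemma hexagon_no_gap:
  assumes B: "circ_le 7"
    and hex: "hexagon x0 x1 x2 x3 x4 x5"
    and v: "E v x0" "E v x1" "v \<notin> {x0, x1, x2, x3, x4, x5}"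
    and u: "u \<in> V" "u \<noteq> v" "u \<notin> {x0, x1, x2, x3, x4, x5}"
  shows False
proof -
  let ?S = "{x0, x1, x2, x3, x4, x5}"
  note gaps = hexagon_gaps[OF B hex v(1,2)]
  have nbr: "\<exists>y\<in>?S. E w y \<and> y \<noteq> a \<and> y \<noteq> b" if "w \<in> V" "w \<notin> ?S" for w a b
    using deg3[OF that(1)] hexagon_outer_independent[OF B hex _ that(2)] by metis
  \<comment> \<open>Three neighbours on the hexagon, consecutive only at \<open>x0, x1\<close>,
    leave the sets \<open>x0, x2, x4\<close>; \<open>x1, x3, x5\<close>; \<open>x0, x1, x3\<close>;
    and \<open>x0, x1, x4\<close>. The formula records what is needed from this list.\<close>
  have type: "(E w x2 \<longrightarrow> E w x0) \<and> (E w x3 \<longrightarrow> E w x1) \<and> (E w x4 \<longrightarrow> E w x0) \<and>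
    (E w x5 \<longrightarrow> E w x1) \<and> (E w x2 \<or> E w x5 \<or> E w x0 \<and> E w x1)"
    if "w \<in> V" "w \<noteq> v" "w \<notin> ?S" for w
  proof -
    have "v \<noteq> w" "{v, w} \<inter> ?S = {}" using that v by auto
    note gaps = gaps[OF this]
    note nbr = nbr[OF that(1,3)]
    show ?thesis
      using gaps nbr[of x2 x4] nbr[of x2 x5] nbr[of x3 x5] nbr[of x3 x0] nbr[of x4 x2] nbr[of x4 x1]
        nbr[of x5 x3] nbr[of x5 x2] nbr[of x1 x3] nbr[of x1 x4] nbr[of x0 x3] nbr[of x0 x4]
      by blast
  qed
  note r1 = hexagon_rotate[OF hex]
  note r2 = hexagon_rotate[OF r1]
  note r3 = hexagon_rotate[OF r2]
  note r4 = hexagon_rotate[OF r3]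
  obtain y2 where y2: "E y2 x2" "y2 \<notin> ?S" "y2 \<in> V"
    using hexagon_outer_nbr[OF r2] sym adj_V by blast
  obtain y3 where y3: "E y3 x3" "y3 \<notin> ?S" "y3 \<in> V"
    using hexagon_outer_nbr[OF r3] sym adj_V by blast
  obtain y4 where y4: "E y4 x4" "y4 \<notin> ?S" "y4 \<in> V"
    using hexagon_outer_nbr[OF r4] sym adj_V by blast
  \<comment> \<open>\<open>w\<close> sees \<open>x0, x2\<close> while \<open>y3\<close> sees
    \<open>x1, x3\<close>, also when \<open>y3\<close> is \<open>v\<close>; the two cross.\<close>
  have T0: False if w: "w \<in> V" "w \<noteq> v" "w \<notin> ?S" "E w x2" for w
  proof -
    have "E w x0" using type w by blast
    moreover have "E y3 x1" using type y3 v by blast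
    moreover have "w \<noteq> y3" using gaps(2)[of w] v w y3 by auto
    ultimately show False using hexagon_cross[OF B hex, of w y3] w y3 by auto
  qed
  have T1: False if w: "w \<in> V" "w \<noteq> v" "w \<notin> ?S" "E w x5" for w
  proof -
    have "E w x1" using type w by blast
    moreover have "E y4 x0" using type y4 v by blast
    moreover have "w \<noteq> y4" using gaps(4)[of w] v w y4 by auto
    ultimately show False using hexagon_cross[OF B r4, of y4 w] w y4 by auto
  qed
  \<comment> \<open>Only the sets containing \<open>x0, x1\<close> remain for \<open>u\<close>, so
    \<open>u\<close> can take the place of \<open>v\<close> in \<open>hexagon_gaps\<close>; hence
    \<open>v\<close> does not see \<open>x2\<close>, and \<open>y2\<close> is another
    vertex.\<close>
  have "E u x0 \<and> E u x1" using type T0 T1 u by blast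
  then have "y2 \<noteq> v" using hexagon_gaps(1)[OF B hex, of u v] u v y2 by auto
  then show False using T0 y2 by blast
qed

text \<open>No outer vertex sees two consecutive vertices, so each sees exactly an alternating
  triple. Outer neighbours of \<open>x0\<close> and of \<open>x1\<close> have different triples, and
  these cross.\<close>

lemma no_hexagon:
  assumes B: "circ_le 7"
    and hex: "hexagon x0 x1 x2 x3 x4 x5"
    and uv: "u \<in> V" "v \<in> V" "u \<noteq> v" "{u, v} \<inter> {x0, x1, x2, x3, x4, x5} = {}"
  shows False
proof -
  let ?S = "{x0, x1, x2, x3, x4, x5}"
  have nbr: "\<exists>y\<in>?S. E w y \<and> y \<noteq> a \<and> y \<noteq> b" if "w \<in> V" "w \<notin> ?S" for w a b
    using deg3[OF that(1)] hexagon_outer_independent[OF B hex _ that(2)] by metis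
  note r1 = hexagon_rotate[OF hex]
  note r2 = hexagon_rotate[OF r1]
  note r3 = hexagon_rotate[OF r2]
  note r4 = hexagon_rotate[OF r3]
  note r5 = hexagon_rotate[OF r4]
  have no_gap: "\<not> (E w x0 \<and> E w x1) \<and> \<not> (E w x1 \<and> E w x2) \<and> \<not> (E w x2 \<and> E w x3) \<and>
    \<not> (E w x3 \<and> E w x4) \<and> \<not> (E w x4 \<and> E w x5) \<and> \<not> (E w x5 \<and> E w x0)"
    if "w \<in> V" "w \<notin> ?S" for w
  proof -
    obtain u' where u': "u' \<in> V" "u' \<noteq> w" "u' \<notin> ?S" using uv by (cases "u = w") auto
    show ?thesis
      using hexagon_no_gap[OF B hex, of w u'] hexagon_no_gap[OF B r1, of w u']
        hexagon_no_gap[OF B r2, of w u'] hexagon_no_gap[OF B r3, of w u']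
        hexagon_no_gap[OF B r4, of w u'] hexagon_no_gap[OF B r5, of w u'] u' that
      by auto
  qed
  have even_type: "E w x2" if "w \<in> V" "w \<notin> ?S" "E w x0" for w
    using no_gap[OF that(1,2)] nbr[OF that(1,2), of x0 x3] nbr[OF that(1,2), of x0 x4] that(3) by blast
  have odd_type: "E w x3" if "w \<in> V" "w \<notin> ?S" "E w x1" for w
    using no_gap[OF that(1,2)] nbr[OF that(1,2), of x1 x4] nbr[OF that(1,2), of x1 x5] that(3) by blast
  obtain y0 where y0: "E y0 x0" "y0 \<notin> ?S" "y0 \<in> V"
    using hexagon_outer_nbr[OF hex] sym adj_V by blast
  obtain y1 where y1: "E y1 x1" "y1 \<notin> ?S" "y1 \<in> V"
    using hexagon_outer_nbr[OF r1] sym adj_V by blast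
  have "y0 \<noteq> y1" using no_gap[OF y0(3,2)] y0 y1 by blast
  then show False
    using hexagon_cross[OF B hex, of y0 y1] y0 y1 even_type[OF y0(3,2,1)] odd_type[OF y1(3,2,1)]
    by auto
qed

section \<open>Induced cycles of length at most 5\<close>

definition pentagon :: "'a \<Rightarrow> 'a \<Rightarrow> 'a \<Rightarrow> 'a \<Rightarrow> 'a \<Rightarrow> bool" where
  "pentagon x0 x1 x2 x3 x4 \<longleftrightarrow> distinct [x0, x1, x2, x3, x4] \<and>
    E x0 x1 \<and> E x1 x2 \<and> E x2 x3 \<and> E x3 x4 \<and> E x4 x0 \<and>
    \<not> E x0 x2 \<and> \<not> E x1 x3 \<and> \<not> E x2 x4 \<and> \<not> E x3 x0 \<and> \<not> E x4 x1"

lemma pentagon_rotate: "pentagon x0 x1 x2 x3 x4 \<Longrightarrow> pentagon x1 x2 x3 x4 x0"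
  and pentagon_reflect: "pentagon x0 x1 x2 x3 x4 \<Longrightarrow> pentagon x0 x4 x3 x2 x1"
  unfolding pentagon_def by (auto simp: E_comm)

lemma pentagon_outer_nbr:
  assumes "pentagon x0 x1 x2 x3 x4"
  shows "\<exists>y. E x0 y \<and> y \<notin> {x0, x1, x2, x3, x4}"
proof -
  have "x0 \<in> V" using assms adj_V by (auto simp: pentagon_def)
  then obtain y where "E x0 y" "y \<noteq> x1" "y \<noteq> x4" using deg3 by blast
  moreover have "\<not> E x0 x2" "\<not> E x0 x3" "\<not> E x0 x0"
    using assms irrefl sym by (auto simp: pentagon_def)
  ultimately show ?thesis by blast
qed

text \<open>As for the hexagon, an ear leaving \<open>x1\<close> either closes a cycle of length at
  least 7 or creates a theta graph; here all three branches have two interior vertices, so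
  \<open>no_theta\<close> applies directly.\<close>

lemma pentagon_ear_2:
  assumes B: "circ_le 6"
    and pent: "pentagon x0 x1 x2 x3 x4"
    and Q: "trail_via E x0 Q x2" "distinct Q" "set Q \<inter> {x0, x1, x2, x3, x4} = {}"
      "2 \<le> length Q"
  shows False
proof -
  note bound = circ_leD[OF B]
  have "length Q \<le> 2" using pent Q bound[of "x0 # Q @ [x2, x3, x4]"]
    by (auto simp: pentagon_def cyc_def successively_trail_via E_comm)
  with Q(4) obtain a b where ab: "Q = [a, b]" by (auto simp: Suc_le_length_iff numeral_2_eq_2)
  obtain y where y: "E x1 y" "y \<notin> {x0, x1, x2, x3, x4}"
    using pentagon_outer_nbr[OF pentagon_rotate[OF pent]] by blast
  have dist: "distinct [x0, x1, x2, x3, x4, a, b]"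
    and adj: "E x0 x1" "E x1 x2" "E x2 x3" "E x3 x4" "E x4 x0" "E x0 a" "E a b" "E b x2"
    and nadj: "\<not> E x4 x2" "\<not> E x3 x0"
    using pent Q ab sym unfolding pentagon_def by auto
  let ?S = "{x0, x1, x2, x3, x4, a, b}"
  have "?S \<subseteq> V" using adj adj_V sym by auto
  moreover have "?S - {x1} \<noteq> {}" "x1 \<in> ?S" using dist by auto
  ultimately obtain P v where v: "v \<in> ?S" "v \<noteq> x1" and P: "trail_via E x1 P v" "distinct P"
    "set P \<inter> ?S = {}" "P = [] \<Longrightarrow> v = y"
    using ear[OF _ _ _ y(1), of ?S] by metis
  have pos: "v \<in> {x0, x2} \<Longrightarrow> 0 < length P" using P y by auto
  note facts = dist adj P(1-3)
  consider "v = x0" | "v = x2" | "v = x3" | "v = x4" | "v = a" | "v = b"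
    using v by blast
  then show False
  proof cases
    case 1
    then have "length P \<le> 1" using facts bound[of "x1 # P @ [x0, x4, x3, x2]"]
      by (auto simp: cyc_def successively_trail_via E_comm)
    with 1 pos obtain w where "P = [w]" by (cases P) auto
    then show ?thesis
      using no_theta[OF B, of "[a, b]" x0 x2 x4 x3 w x1] 1 facts nadj by (auto simp: E_comm)
  next
    case 2
    then have "length P \<le> 1" using facts bound[of "x1 # P @ [x2, x3, x4, x0]"]
      by (auto simp: cyc_def successively_trail_via E_comm)
    with 2 pos obtain w where "P = [w]" by (cases P) auto
    then show ?thesis
      using no_theta[OF B, of "[a, b]" x0 x2 x4 x3 x1 w] 2 facts nadj by (auto simp: E_comm)
  next
    case 3
    then show ?thesis using facts bound[of "x1 # P @ [x3, x4, x0, a, b, x2]"]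
      by (auto simp: cyc_def successively_trail_via E_comm)
  next
    case 4
    then show ?thesis using facts bound[of "x1 # P @ [x4, x3, x2, b, a, x0]"]
      by (auto simp: cyc_def successively_trail_via E_comm)
  next
    case 5
    then show ?thesis using facts bound[of "x1 # P @ [a, b, x2, x3, x4, x0]"]
      by (auto simp: cyc_def successively_trail_via E_comm)
  next
    case 6
    then show ?thesis using facts bound[of "x1 # P @ [b, a, x0, x4, x3, x2]"]
      by (auto simp: cyc_def successively_trail_via E_comm)
  qed
qed

lemma pentagon_ear:
  assumes B: "circ_le 6"
    and pent: "pentagon x0 x1 x2 x3 x4"
    and Q: "trail_via E x0 Q w" "distinct Q" "set Q \<inter> {x0, x1, x2, x3, x4} = {}"
      "2 \<le> length Q"
    and w: "w \<in> {x1, x2, x3, x4}"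
  shows False
proof -
  note bound = circ_leD[OF B]
  consider "w = x1" | "w = x2" | "w = x3" | "w = x4" using w by blast
  then show False
  proof cases
    case 1
    then show ?thesis using pent Q bound[of "x0 # Q @ [x1, x2, x3, x4]"]
      by (auto simp: pentagon_def cyc_def successively_trail_via E_comm)
  next
    case 2
    then show ?thesis using pentagon_ear_2[OF B pent] Q by simp
  next
    case 3
    then show ?thesis using pentagon_ear_2[OF B pentagon_reflect[OF pent], of Q] Q by auto
  next
    case 4
    then show ?thesis using pent Q bound[of "x0 # Q @ [x4, x3, x2, x1]"]
      by (auto simp: pentagon_def cyc_def successively_trail_via E_comm)
  qed
qed

lemma pentagon_outer_independent:
  assumes B: "circ_le 6"
    and pent: "pentagon x0 x1 x2 x3 x4"
    and uv: "E u v" "u \<notin> {x0, x1, x2, x3, x4}"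
  shows "v \<in> {x0, x1, x2, x3, x4}"
proof (rule ccontr)
  let ?S = "{x0, x1, x2, x3, x4}"
  assume "v \<notin> ?S"
  moreover have "?S \<subseteq> V" "x0 \<noteq> x1" "x0 \<in> ?S" "x1 \<in> ?S"
    using pent adj_V by (auto simp: pentagon_def)
  ultimately obtain P z w where P: "z \<in> ?S" "w \<in> ?S" "z \<noteq> w" "trail_via E z P w" "distinct P"
    "set P \<inter> ?S = {}" "2 \<le> length P"
    using long_ear[OF _ uv, of x0 x1] by metis
  note r1 = pentagon_rotate[OF pent]
  note r2 = pentagon_rotate[OF r1]
  note r3 = pentagon_rotate[OF r2]
  note r4 = pentagon_rotate[OF r3]
  consider "z = x0" | "z = x1" | "z = x2" | "z = x3" | "z = x4" using P by blast
  then show False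
  proof cases
    case 1
    then show ?thesis using pentagon_ear[OF B pent, of P w] P by auto
  next
    case 2
    then show ?thesis using pentagon_ear[OF B r1, of P w] P by auto
  next
    case 3
    then show ?thesis using pentagon_ear[OF B r2, of P w] P by auto
  next
    case 4
    then show ?thesis using pentagon_ear[OF B r3, of P w] P by auto
  next
    case 5
    then show ?thesis using pentagon_ear[OF B r4, of P w] P by auto
  qed
qed

lemma pentagon_gaps:
  assumes B: "circ_le 6"
    and "pentagon x0 x1 x2 x3 x4"
    and "E v x0" "E v x1" "v \<noteq> w" "{v, w} \<inter> {x0, x1, x2, x3, x4} = {}"
  shows "\<not> (E w x1 \<and> E w x2)" "\<not> (E w x2 \<and> E w x3)" "\<not> (E w x3 \<and> E w x4)"
    "\<not> (E w x4 \<and> E w x0)"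
proof -
  note bound = circ_leD[OF B]
  note facts = assms(2-)
  show "\<not> (E w x1 \<and> E w x2)" using facts bound[of "[x0, v, x1, w, x2, x3, x4]"]
    by (auto simp: pentagon_def cyc_def E_comm)
  show "\<not> (E w x2 \<and> E w x3)" using facts bound[of "[x0, v, x1, x2, w, x3, x4]"]
    by (auto simp: pentagon_def cyc_def E_comm)
  show "\<not> (E w x3 \<and> E w x4)" using facts bound[of "[x0, v, x1, x2, x3, w, x4]"]
    by (auto simp: pentagon_def cyc_def E_comm)
  show "\<not> (E w x4 \<and> E w x0)" using facts bound[of "[x0, v, x1, x2, x3, x4, w]"]
    by (auto simp: pentagon_def cyc_def E_comm)
qed

text \<open>An outer neighbour \<open>y\<close> of \<open>x2\<close> other than \<open>v\<close>
  would need both \<open>x4\<close> and \<open>x0\<close>, which \<open>pentagon_gaps\<close>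
  forbids. So \<open>v\<close> sees \<open>x0, x1, x2\<close>, and then \<open>w\<close> sees no two
  consecutive vertices, although it has three neighbours among five.\<close>

lemma pentagon_no_gap:
  assumes B: "circ_le 6"
    and pent: "pentagon x0 x1 x2 x3 x4"
    and v: "E v x0" "E v x1" "v \<notin> {x0, x1, x2, x3, x4}"
    and w: "w \<in> V" "w \<noteq> v" "w \<notin> {x0, x1, x2, x3, x4}"
  shows False
proof -
  let ?S = "{x0, x1, x2, x3, x4}"
  have nbr: "\<exists>y\<in>?S. E u y \<and> y \<noteq> a \<and> y \<noteq> b" if "u \<in> V" "u \<notin> ?S" for u a b
    using deg3[OF that(1)] pentagon_outer_independent[OF B pent _ that(2)] by metis
  note r1 = pentagon_rotate[OF pent]
  note r2 = pentagon_rotate[OF r1]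
  obtain y where y: "E y x2" "y \<notin> ?S" "y \<in> V"
    using pentagon_outer_nbr[OF r2] sym adj_V by blast
  have gaps: "\<not> (E u x1 \<and> E u x2)" "\<not> (E u x2 \<and> E u x3)" "\<not> (E u x3 \<and> E u x4)"
    "\<not> (E u x4 \<and> E u x0)" if "u \<noteq> v" "u \<notin> ?S" for u
    using pentagon_gaps[OF B pent v(1,2), of u] that v(3) by auto
  have "y = v"
  proof (rule ccontr)
    assume "y \<noteq> v"
    from gaps[OF this y(2)] show False
      using y nbr[OF y(3,2), of x2 x4] nbr[OF y(3,2), of x2 x0] by blast
  qed
  then have "\<not> (E w x0 \<and> E w x1)" using pentagon_gaps(4)[OF B r1, of v w] v w y by auto
  with gaps[OF w(2,3)] show False
    using nbr[OF w(1,3), of x0 x2] nbr[OF w(1,3), of x1 x3] nbr[OF w(1,3), of x2 x4]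
      nbr[OF w(1,3), of x3 x0] nbr[OF w(1,3), of x4 x1] by blast
qed

text \<open>Three of five cyclically ordered vertices include two consecutive ones, against
  \<open>pentagon_no_gap\<close>.\<close>

lemma no_pentagon:
  assumes B: "circ_le 6"
    and pent: "pentagon x0 x1 x2 x3 x4"
    and uv: "u \<in> V" "v \<in> V" "u \<noteq> v" "{u, v} \<inter> {x0, x1, x2, x3, x4} = {}"
  shows False
proof -
  let ?S = "{x0, x1, x2, x3, x4}"
  have u: "u \<notin> ?S" and v: "v \<noteq> u" "v \<notin> ?S" using uv by auto
  have nbr: "\<exists>y\<in>?S. E u y \<and> y \<noteq> a \<and> y \<noteq> b" for a b
    using deg3[OF uv(1)] pentagon_outer_independent[OF B pent _ u] by metis
  note r1 = pentagon_rotate[OF pent]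
  note r2 = pentagon_rotate[OF r1]
  note r3 = pentagon_rotate[OF r2]
  note r4 = pentagon_rotate[OF r3]
  have "\<not> (E u x0 \<and> E u x1)" "\<not> (E u x1 \<and> E u x2)" "\<not> (E u x2 \<and> E u x3)"
    "\<not> (E u x3 \<and> E u x4)" "\<not> (E u x4 \<and> E u x0)"
    using pentagon_no_gap[OF B pent, of u v] pentagon_no_gap[OF B r1, of u v]
      pentagon_no_gap[OF B r2, of u v] pentagon_no_gap[OF B r3, of u v]
      pentagon_no_gap[OF B r4, of u v] u v uv(2) by auto
  then show False
    using nbr[of x0 x2] nbr[of x1 x3] nbr[of x2 x4] nbr[of x3 x0] nbr[of x4 x1] by blast
qed

section \<open>Induced cycles of length 4\<close>

definition square :: "'a \<Rightarrow> 'a \<Rightarrow> 'a \<Rightarrow> 'a \<Rightarrow> bool" where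
  "square x0 x1 x2 x3 \<longleftrightarrow> distinct [x0, x1, x2, x3] \<and>
    E x0 x1 \<and> E x1 x2 \<and> E x2 x3 \<and> E x3 x0 \<and> \<not> E x0 x2 \<and> \<not> E x1 x3"

lemma square_rotate: "square x0 x1 x2 x3 \<Longrightarrow> square x1 x2 x3 x0"
  unfolding square_def by (auto simp: E_comm)

lemma square_outer_nbr:
  assumes "square x0 x1 x2 x3"
  shows "\<exists>y. E x0 y \<and> y \<notin> {x0, x1, x2, x3}"
proof -
  have "x0 \<in> V" using assms adj_V by (auto simp: square_def)
  then obtain y where "E x0 y" "y \<noteq> x1" "y \<noteq> x3" using deg3 by blast
  moreover have "\<not> E x0 x2" "\<not> E x0 x0"
    using assms irrefl sym by (auto simp: square_def)
  ultimately show ?thesis by blast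
qed

text \<open>Every ear leaving \<open>x1\<close> closes a cycle of length at least 6, so no theta
  graph has to be excluded here.\<close>

lemma square_ear_2:
  assumes B: "circ_le 5"
    and square: "square x0 x1 x2 x3"
    and Q: "trail_via E x0 Q x2" "distinct Q" "set Q \<inter> {x0, x1, x2, x3} = {}"
      "2 \<le> length Q"
  shows False
proof -
  note bound = circ_leD[OF B]
  have "length Q \<le> 2" using square Q bound[of "x0 # Q @ [x2, x3]"]
    by (auto simp: square_def cyc_def successively_trail_via E_comm)
  with Q(4) obtain a b where ab: "Q = [a, b]" by (auto simp: Suc_le_length_iff numeral_2_eq_2)
  obtain y where y: "E x1 y" "y \<notin> {x0, x1, x2, x3}"
    using square_outer_nbr[OF square_rotate[OF square]] by blast
  have dist: "distinct [x0, x1, x2, x3, a, b]"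
    and adj: "E x0 x1" "E x1 x2" "E x2 x3" "E x3 x0" "E x0 a" "E a b" "E b x2"
    using square Q ab sym unfolding square_def by auto
  let ?S = "{x0, x1, x2, x3, a, b}"
  have "?S \<subseteq> V" using adj adj_V sym by auto
  moreover have "?S - {x1} \<noteq> {}" "x1 \<in> ?S" using dist by auto
  ultimately obtain P v where v: "v \<in> ?S" "v \<noteq> x1" and P: "trail_via E x1 P v" "distinct P"
    "set P \<inter> ?S = {}" "P = [] \<Longrightarrow> v = y"
    using ear[OF _ _ _ y(1), of ?S] by metis
  have pos: "v \<in> {x0, x2} \<Longrightarrow> 0 < length P" using P y by auto
  note facts = dist adj P(1-3)
  consider "v = x0" | "v = x2" | "v = x3" | "v = a" | "v = b"
    using v by blast
  then show False
  proof cases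
    case 1
    then show ?thesis using pos facts bound[of "x1 # P @ [x0, a, b, x2]"]
      by (auto simp: cyc_def successively_trail_via E_comm)
  next
    case 2
    then show ?thesis using pos facts bound[of "x1 # P @ [x2, b, a, x0]"]
      by (auto simp: cyc_def successively_trail_via E_comm)
  next
    case 3
    then show ?thesis using facts bound[of "x1 # P @ [x3, x0, a, b, x2]"]
      by (auto simp: cyc_def successively_trail_via E_comm)
  next
    case 4
    then show ?thesis using facts bound[of "x1 # P @ [a, b, x2, x3, x0]"]
      by (auto simp: cyc_def successively_trail_via E_comm)
  next
    case 5
    then show ?thesis using facts bound[of "x1 # P @ [b, a, x0, x3, x2]"]
      by (auto simp: cyc_def successively_trail_via E_comm)
  qed
qed

lemma square_ear:
  assumes B: "circ_le 5"
    and square: "square x0 x1 x2 x3"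
    and Q: "trail_via E x0 Q w" "distinct Q" "set Q \<inter> {x0, x1, x2, x3} = {}"
      "2 \<le> length Q"
    and w: "w \<in> {x1, x2, x3}"
  shows False
proof -
  note bound = circ_leD[OF B]
  consider "w = x1" | "w = x2" | "w = x3" using w by blast
  then show False
  proof cases
    case 1
    then show ?thesis using square Q bound[of "x0 # Q @ [x1, x2, x3]"]
      by (auto simp: square_def cyc_def successively_trail_via E_comm)
  next
    case 2
    then show ?thesis using square_ear_2[OF B square] Q by simp
  next
    case 3
    then show ?thesis using square Q bound[of "x0 # Q @ [x3, x2, x1]"]
      by (auto simp: square_def cyc_def successively_trail_via E_comm)
  qed
qed

lemma square_outer_independent:
  assumes B: "circ_le 5"
    and square: "square x0 x1 x2 x3"
    and uv: "E u v" "u \<notin> {x0, x1, x2, x3}"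
  shows "v \<in> {x0, x1, x2, x3}"
proof (rule ccontr)
  let ?S = "{x0, x1, x2, x3}"
  assume "v \<notin> ?S"
  moreover have "?S \<subseteq> V" "x0 \<noteq> x1" "x0 \<in> ?S" "x1 \<in> ?S"
    using square adj_V by (auto simp: square_def)
  ultimately obtain P z w where P: "z \<in> ?S" "w \<in> ?S" "z \<noteq> w" "trail_via E z P w" "distinct P"
    "set P \<inter> ?S = {}" "2 \<le> length P"
    using long_ear[OF _ uv, of x0 x1] by metis
  note r1 = square_rotate[OF square]
  note r2 = square_rotate[OF r1]
  note r3 = square_rotate[OF r2]
  consider "z = x0" | "z = x1" | "z = x2" | "z = x3" using P by blast
  then show False
  proof cases
    case 1
    then show ?thesis using square_ear[OF B square, of P w] P by auto
  next
    case 2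
    then show ?thesis using square_ear[OF B r1, of P w] P by auto
  next
    case 3
    then show ?thesis using square_ear[OF B r2, of P w] P by auto
  next
    case 4
    then show ?thesis using square_ear[OF B r3, of P w] P by auto
  qed
qed

lemma square_gaps:
  assumes B: "circ_le 5"
    and "square x0 x1 x2 x3"
    and "E v x0" "E v x1" "v \<noteq> w" "{v, w} \<inter> {x0, x1, x2, x3} = {}"
  shows "\<not> (E w x1 \<and> E w x2)" "\<not> (E w x2 \<and> E w x3)" "\<not> (E w x3 \<and> E w x0)"
proof -
  note bound = circ_leD[OF B]
  note facts = assms(2-)
  show "\<not> (E w x1 \<and> E w x2)" using facts bound[of "[x0, v, x1, w, x2, x3]"]
    by (auto simp: square_def cyc_def E_comm)
  show "\<not> (E w x2 \<and> E w x3)" using facts bound[of "[x0, v, x1, x2, w, x3]"]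
    by (auto simp: square_def cyc_def E_comm)
  show "\<not> (E w x3 \<and> E w x0)" using facts bound[of "[x0, v, x1, x2, x3, w]"]
    by (auto simp: square_def cyc_def E_comm)
qed

text \<open>Three neighbours among four vertices include the ends of an edge other than
  \<open>x0 x1\<close>, into which \<open>w\<close> could be inserted.\<close>

lemma square_no_gap:
  assumes B: "circ_le 5"
    and square: "square x0 x1 x2 x3"
    and v: "E v x0" "E v x1" "v \<notin> {x0, x1, x2, x3}"
    and w: "w \<in> V" "w \<noteq> v" "w \<notin> {x0, x1, x2, x3}"
  shows False
proof -
  let ?S = "{x0, x1, x2, x3}"
  have nbr: "\<exists>y\<in>?S. E w y \<and> y \<noteq> a \<and> y \<noteq> b" for a b
    using deg3[OF w(1)] square_outer_independent[OF B square _ w(3)] by metis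
  have "v \<noteq> w" "{v, w} \<inter> ?S = {}" using v w by auto
  from square_gaps[OF B square v(1,2) this] show False
    using nbr[of x0 x1] nbr[of x0 x2] nbr[of x1 x3] by blast
qed

lemma no_square:
  assumes B: "circ_le 5"
    and square: "square x0 x1 x2 x3"
    and uv: "u \<in> V" "v \<in> V" "u \<noteq> v" "{u, v} \<inter> {x0, x1, x2, x3} = {}"
  shows False
proof -
  let ?S = "{x0, x1, x2, x3}"
  have u: "u \<notin> ?S" and v: "v \<noteq> u" "v \<notin> ?S" using uv by auto
  have nbr: "\<exists>y\<in>?S. E u y \<and> y \<noteq> a \<and> y \<noteq> b" for a b
    using deg3[OF uv(1)] square_outer_independent[OF B square _ u] by metis
  note r1 = square_rotate[OF square]
  note r2 = square_rotate[OF r1]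
  note r3 = square_rotate[OF r2]
  have "\<not> (E u x0 \<and> E u x1)" "\<not> (E u x1 \<and> E u x2)" "\<not> (E u x2 \<and> E u x3)"
    "\<not> (E u x3 \<and> E u x0)"
    using square_no_gap[OF B square, of u v] square_no_gap[OF B r1, of u v]
      square_no_gap[OF B r2, of u v] square_no_gap[OF B r3, of u v] u v uv(2) by auto
  then show False
    using nbr[of x0 x2] nbr[of x1 x3] by blast
qed

section \<open>Triangles\<close>

text \<open>A long ear together with the third vertex \<open>t\<close> is a cycle of length at least
  5, so outer vertices have neighbours only on the triangle and hence see all of it. Two of them can
  then be inserted into different edges.\<close>

lemma no_triangle:
  assumes B: "circ_le 4"
    and tri: "E x0 x1" "E x1 x2" "E x2 x0"
    and uv: "u \<in> V" "v \<in> V" "u \<noteq> v" "{u, v} \<inter> {x0, x1, x2} = {}"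
  shows False
proof -
  note bound = circ_leD[OF B]
  let ?S = "{x0, x1, x2}"
  have ne: "distinct [x0, x1, x2]" using tri adj_neq by auto
  have indep: "y \<in> ?S" if wy: "E w y" "w \<notin> ?S" for w y
  proof (rule ccontr)
    assume "y \<notin> ?S"
    moreover have "?S \<subseteq> V" "x0 \<noteq> x1" "x0 \<in> ?S" "x1 \<in> ?S"
      using tri adj_V ne by auto
    ultimately obtain P z w where P: "z \<in> ?S" "w \<in> ?S" "z \<noteq> w" "trail_via E z P w" "distinct P"
      "set P \<inter> ?S = {}" "2 \<le> length P"
      using long_ear[OF _ wy, of x0 x1] by metis
    obtain t where "t \<in> ?S" "t \<noteq> z" "t \<noteq> w" using ne P by auto
    then have "E w t" "E t z" "t \<notin> set P" using P tri sym by auto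
    then show False using bound[of "z # P @ [w, t]"] P \<open>t \<noteq> z\<close> \<open>t \<noteq> w\<close>
      by (auto simp: cyc_def successively_trail_via)
  qed
  have nbr: "\<exists>y\<in>?S. E w y \<and> y \<noteq> a \<and> y \<noteq> b" if "w \<in> V" "w \<notin> ?S" for w a b
    using deg3[OF that(1)] indep[OF _ that(2)] by metis
  have all: "E w x0 \<and> E w x1 \<and> E w x2" if "w \<in> V" "w \<notin> ?S" for w
    using nbr[OF that, of x0 x1] nbr[OF that, of x0 x2] nbr[OF that, of x1 x2] by blast
  have "u \<notin> ?S" "v \<notin> ?S" using uv by auto
  then show False using all[of u] all[of v] uv tri ne bound[of "[x0, u, x1, v, x2]"] sym
    by (auto simp: cyc_def E_comm)
qed

section \<open>Chordless cycles\<close>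

lemma successively_V: "successively E (xs @ [y]) \<Longrightarrow> set xs \<subseteq> V"
  by (induction xs) (auto simp: successively_Cons hd_append adj_V split: if_splits)

lemma cyc_V: "cyc E xs \<Longrightarrow> set xs \<subseteq> V"
  using successively_V by (auto simp: cyc_def)

text \<open>If the outer neighbours found for \<open>a\<close> and \<open>b\<close> coincide,
  inserting this vertex between them gives a cycle, which misses a further vertex because it is not
  hamiltonian.\<close>

lemma two_outer_vertices:
  assumes ham: "\<And>ys. cyc E ys \<Longrightarrow> set ys \<noteq> V"
    and xs: "xs = a # b # zs" "cyc E xs"
    and out: "\<exists>y. E a y \<and> y \<notin> set xs" "\<exists>y. E b y \<and> y \<notin> set xs"
  obtains u v where "u \<in> V" "v \<in> V" "u \<noteq> v" "{u, v} \<inter> set xs = {}"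
proof -
  obtain y z where yz: "E a y" "y \<notin> set xs" "E b z" "z \<notin> set xs" using out by blast
  then have V: "y \<in> V" "z \<in> V" using adj_V sym by blast+
  show ?thesis
  proof (cases "y = z")
    case False
    with yz V show ?thesis by (intro that[of y z]) auto
  next
    case True
    have "cyc E (a # y # b # zs)" using xs yz True by (auto simp: cyc_def E_comm)
    with ham cyc_V have "set (a # y # b # zs) \<subset> V" by blast
    then obtain v where "v \<in> V" "v \<notin> set (a # y # b # zs)" by blast
    with yz V xs show ?thesis by (intro that[of y v]) auto
  qed
qed

lemma circ_gt_chordless:
  assumes xs: "cyc E xs" "chordless E xs" "length xs \<le> 6"
    and ham: "\<And>ys. cyc E ys \<Longrightarrow> set ys \<noteq> V"
  shows "\<not> circ_le (length xs + 1)"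
proof
  assume B: "circ_le (length xs + 1)"
  have chord: "\<not> E (xs ! i) (xs ! j)" if "i < length xs" "j < length xs"
    "j \<noteq> Suc i mod length xs" "i \<noteq> Suc j mod length xs" for i j
    using xs(2) that unfolding chordless_def by blast
  have "3 \<le> length xs" using xs by (auto simp: cyc_def)
  then consider "length xs = 3" | "length xs = 4" | "length xs = 5" | "length xs = 6"
    using xs by linarith
  then show False
  proof cases
    case 1
    then obtain x0 x1 x2 where x: "xs = [x0, x1, x2]"
      by (auto simp: length_Suc_conv numeral_eq_Suc)
    have tri: "E x0 x1" "E x1 x2" "E x2 x0" using xs x by (auto simp: cyc_def)
    have "x0 \<in> V" "x1 \<in> V" using tri adj_V by blast+
    then have "\<exists>y. E x0 y \<and> y \<notin> set xs" "\<exists>y. E x1 y \<and> y \<notin> set xs"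
      using deg3[of x0 x1 x2] deg3[of x1 x0 x2] irrefl x by auto
    then obtain u v where "u \<in> V" "v \<in> V" "u \<noteq> v" "{u, v} \<inter> set xs = {}"
      using two_outer_vertices[OF ham x xs(1)] by metis
    moreover have "circ_le 4" using B 1 by simp
    ultimately show False using no_triangle[OF _ tri] x by simp
  next
    case 2
    then obtain x0 x1 x2 x3 where x: "xs = [x0, x1, x2, x3]"
      by (auto simp: length_Suc_conv numeral_eq_Suc)
    have square: "square x0 x1 x2 x3"
      using xs(1) x chord[of 0 2] chord[of 1 3] by (auto simp: square_def cyc_def)
    then have "\<exists>y. E x0 y \<and> y \<notin> set xs" "\<exists>y. E x1 y \<and> y \<notin> set xs"
      using square_outer_nbr square_rotate x by fastforce+
    then obtain u v where "u \<in> V" "v \<in> V" "u \<noteq> v" "{u, v} \<inter> set xs = {}"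
      using two_outer_vertices[OF ham x xs(1)] by metis
    moreover have "circ_le 5" using B 2 by simp
    ultimately show False using no_square[OF _ square] x by simp
  next
    case 3
    then obtain x0 x1 x2 x3 x4 where x: "xs = [x0, x1, x2, x3, x4]"
      by (auto simp: length_Suc_conv numeral_eq_Suc)
    have pent: "pentagon x0 x1 x2 x3 x4"
      using xs(1) x chord[of 0 2] chord[of 1 3] chord[of 2 4] chord[of 3 0] chord[of 4 1]
      by (auto simp: pentagon_def cyc_def)
    then have "\<exists>y. E x0 y \<and> y \<notin> set xs" "\<exists>y. E x1 y \<and> y \<notin> set xs"
      using pentagon_outer_nbr pentagon_rotate x by fastforce+
    then obtain u v where "u \<in> V" "v \<in> V" "u \<noteq> v" "{u, v} \<inter> set xs = {}"
      using two_outer_vertices[OF ham x xs(1)] by metis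
    moreover have "circ_le 6" using B 3 by simp
    ultimately show False using no_pentagon[OF _ pent] x by simp
  next
    case 4
    then obtain x0 x1 x2 x3 x4 x5 where x: "xs = [x0, x1, x2, x3, x4, x5]"
      by (auto simp: length_Suc_conv numeral_eq_Suc)
    have hex: "hexagon x0 x1 x2 x3 x4 x5"
      using xs(1) x chord[of 0 2] chord[of 1 3] chord[of 2 4] chord[of 3 5] chord[of 4 0]
        chord[of 5 1] chord[of 0 3] chord[of 1 4] chord[of 2 5]
      by (auto simp: hexagon_def cyc_def)
    then have "\<exists>y. E x0 y \<and> y \<notin> set xs" "\<exists>y. E x1 y \<and> y \<notin> set xs"
      using hexagon_outer_nbr hexagon_rotate x by fastforce+
    then obtain u v where "u \<in> V" "v \<in> V" "u \<noteq> v" "{u, v} \<inter> set xs = {}"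
      using two_outer_vertices[OF ham x xs(1)] by metis
    moreover have "circ_le 7" using B 4 by simp
    ultimately show False using no_hexagon[OF _ hex] x by simp
  qed
qed

section \<open>Existence of a chordless cycle\<close>

text \<open>Two neighbours of \<open>x\<close> are joined by a path avoiding
  \<open>x\<close>.\<close>

lemma ex_cyc:
  assumes "x \<in> V"
  shows "\<exists>xs. cyc E xs"
proof -
  obtain y where y: "E x y" using deg3[OF assms] by blast
  obtain z where z: "E x z" "z \<noteq> y" using deg3[OF assms] by blast
  have V: "y \<in> V" "z \<in> V" "y \<noteq> x" "z \<noteq> x" using y z adj_V sym adj_neq by blast+
  obtain P where "trail_via E y P z" "distinct (y # P)" "z \<notin> set P" "x \<notin> set P"
    using path_to_set[of x y "{z}"] assms y z V by auto
  with y z V show ?thesis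
    by (intro exI[of _ "x # y # P @ [z]"]) (auto simp: cyc_def successively_trail_via E_comm)
qed

lemma shortest_cyc_chordless:
  assumes xs: "cyc E xs" and min: "\<And>ys. cyc E ys \<Longrightarrow> length xs \<le> length ys"
  shows "chordless E xs"
proof -
  \<comment> \<open>The second alternative is the closing edge from the last vertex to the first;
    any other edge between non-successive positions cuts off a shorter cycle.\<close>
  have consecutive: "j = Suc i \<or> (i = 0 \<and> Suc j = length xs)"
    if ij: "i < j" "j < length xs" "E (xs ! i) (xs ! j)" for i j
  proof (rule ccontr)
    assume far: "\<not> ?thesis"
    \<comment> \<open>\<open>M\<close> consists of the vertices strictly between positions
      \<open>i\<close> and \<open>j\<close>; with both ends it forms the shorter cycle.\<close>
    define M where "M = take (j - Suc i) (drop (Suc i) xs)"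
    have "xs = take i xs @ xs ! i # drop (Suc i) xs" using ij by (simp add: id_take_nth_drop)
    also have "drop (Suc i) xs = M @ drop j xs"
      using ij by (simp add: M_def) (metis Suc_leI append_take_drop_id drop_drop le_add_diff_inverse2)
    also have "drop j xs = xs ! j # drop (Suc j) xs" using ij by (simp add: Cons_nth_drop_Suc)
    finally have split: "xs = take i xs @ xs ! i # M @ xs ! j # drop (Suc j) xs" .
    let ?ys = "xs ! i # M @ [xs ! j]"
    have len: "length M = j - Suc i" using ij by (simp add: M_def)
    have "distinct ?ys" using xs split by (metis cyc_def distinct_append distinct.simps(2)
      append.assoc append_Cons append_Nil)
    moreover have "trail_via E (xs ! i) M (xs ! j)"
    proof -
      have "xs @ [hd xs] = take i xs @ ?ys @ drop (Suc j) xs @ [hd xs]"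
        by (subst (1) split) simp
      with xs have "successively E (take i xs @ ?ys @ drop (Suc j) xs @ [hd xs])"
        by (simp add: cyc_def)
      then show ?thesis unfolding trail_via_def by (simp only: successively_append_iff)
    qed
    moreover have "3 \<le> length ?ys" using len ij far by auto
    ultimately have "cyc E ?ys" using sym[OF ij(3)] by (simp add: cyc_def successively_trail_via)
    from min[OF this] show False using len ij far by auto
  qed
  show ?thesis unfolding chordless_def
  proof (intro allI impI)
    fix i j assume ij: "i < length xs" "j < length xs" "E (xs ! i) (xs ! j)"
    then have "i \<noteq> j" using irrefl by auto
    then consider "i < j" | "j < i" by linarith
    then show "j = Suc i mod length xs \<or> i = Suc j mod length xs"
    proof cases
      case 1
      then show ?thesis using consecutive[of i j] ij by auto
    next
      case 2
      then show ?thesis using consecutive[of j i] ij sym by auto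
    qed
  qed
qed

end

section \<open>Cycles as lists of arcs\<close>

lemma (in wf_digraph) cas_successively:
  assumes "cas u p v" "set p \<subseteq> arcs G"
  shows "successively (dominates G) (map (tail G) p @ [v])"
  using assms
proof (induction p arbitrary: u)
  case (Cons e p)
  have "hd (map (tail G) p @ [v]) = head G e" using Cons.prems by (cases p) auto
  moreover have "tail G e \<rightarrow> head G e" using Cons.prems by (auto intro: dominatesI simp: arc_to_ends_def)
  ultimately show ?case using Cons by (auto simp: successively_Cons)
qed auto

lemma (in wf_digraph) successively_cas:
  assumes "successively (dominates G) (xs @ [v])"
  shows "\<exists>p. map (tail G) p = xs \<and> set p \<subseteq> arcs G \<and> cas (hd (xs @ [v])) p v"
  using assms
proof (induction xs)
  case (Cons x xs)
  then obtain p where p: "map (tail G) p = xs" "set p \<subseteq> arcs G" "cas (hd (xs @ [v])) p v"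
    by (auto simp: successively_Cons)
  from Cons.prems have "x \<rightarrow> hd (xs @ [v])" by (auto simp: successively_Cons)
  then obtain e where "e \<in> arcs G" "tail G e = x" "head G e = hd (xs @ [v])" by blast
  with p show ?case by (intro exI[of _ "e # p"]) auto
qed auto

lemma (in wf_digraph) map_tail_cas:
  assumes "cas u p v"
  shows "map (tail G) p @ [v] = u # map (head G) p"
  using assms by (induction u p v rule: cas.induct) auto

lemma (in wf_digraph) cyc_map_tail:
  assumes "ucycle G p"
  shows "cyc (dominates G) (map (tail G) p)"
    and "i < length p \<Longrightarrow> head G (p ! i) = map (tail G) p ! (Suc i mod length p)"
    and "set p \<subseteq> arcs G"
proof -
  obtain u where u: "awalk u p u" "distinct (tl (awalk_verts u p))" "p \<noteq> []" "3 \<le> length p"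
    using assms by (auto simp: ucycle_def cycle_def)
  then have cas: "cas u p u" "set p \<subseteq> arcs G" by auto
  then have eq: "map (tail G) p @ [u] = u # map (head G) p" by (simp add: map_tail_cas)
  then have hd: "hd (map (tail G) p) = u" using u(3) by (cases p) auto
  \<comment> \<open>\<open>cycle\<close> requires distinctness of
    \<open>tl (awalk_verts u p)\<close>, which is the list of heads. Around a closed walk heads and
    tails form the same multiset, so distinctness passes to the tails.\<close>
  have "distinct (map (head G) p)" using u awalk_verts_conv'[OF cas(1)] by simp
  moreover have "mset (map (tail G) p) = mset (map (head G) p)"
    using arg_cong[OF eq, of mset] by simp
  ultimately have "distinct (map (tail G) p)" using mset_eq_imp_distinct_iff by blast
  then show "cyc (dominates G) (map (tail G) p)"
    using cas_successively[OF cas] u hd by (simp add: cyc_def)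
  show "set p \<subseteq> arcs G" by fact
  show "head G (p ! i) = map (tail G) p ! (Suc i mod length p)" if "i < length p"
  proof -
    have "head G (p ! i) = (map (tail G) p @ [u]) ! Suc i" using that by (simp add: eq)
    also have "\<dots> = map (tail G) p ! (Suc i mod length p)"
    proof (cases "Suc i = length p")
      case True
      then show ?thesis using hd u by (simp add: nth_append hd_conv_nth)
    next
      case False
      then show ?thesis using that by (simp add: nth_append)
    qed
    finally show ?thesis .
  qed
qed

lemma (in wf_digraph) ex_ucycle:
  assumes "cyc (dominates G) xs"
  obtains p where "ucycle G p" "map (tail G) p = xs"
proof -
  have xs: "xs \<noteq> []" "3 \<le> length xs" "distinct xs" using assms by (auto simp: cyc_def)
  obtain p where p: "map (tail G) p = xs" "set p \<subseteq> arcs G" "cas (hd (xs @ [hd xs])) p (hd xs)"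
    using successively_cas[of xs "hd xs"] assms by (auto simp: cyc_def)
  then have cas: "cas (hd xs) p (hd xs)" using xs by simp
  have "hd xs # map (head G) p = xs @ [hd xs]" using map_tail_cas[OF cas] p by simp
  then have "map (head G) p = tl xs @ [hd xs]" using xs by (cases xs) auto
  then have "distinct (map (head G) p)" using xs by (cases xs) auto
  moreover have "p \<noteq> []" using p xs by auto
  moreover have "hd xs \<in> verts G"
  proof -
    have "hd p \<in> arcs G" "tail G (hd p) = hd xs"
      using p(1,2) \<open>p \<noteq> []\<close> by (auto simp: hd_map)
    then show ?thesis by (metis tail_in_verts)
  qed
  moreover have "length p = length xs" using p(1) by (metis length_map)
  ultimately have "ucycle G p" using cas p xs awalk_verts_conv'[OF cas]
    by (auto simp: ucycle_def cycle_def awalk_def)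
  with p that show ?thesis by blast
qed

lemma (in wf_digraph) induced_cycle_iff_chordless:
  assumes p: "ucycle G p"
  shows "induced_cycle G p \<longleftrightarrow> chordless (dominates G) (map (tail G) p)"
proof -
  let ?xs = "map (tail G) p"
  have dist: "distinct ?xs" using cyc_map_tail(1)[OF p] by (simp add: cyc_def)
  \<comment> \<open>Distinct tails determine the arc, so an ordered pair of cycle vertices belongs
    to an arc of \<open>p\<close> only in successive positions. Chords of \<open>p\<close> thereby
    become edges between non-successive positions.\<close>
  have ends: "(?xs ! i, ?xs ! j) \<in> arc_to_ends G ` set p \<longleftrightarrow> j = Suc i mod length p"
    if ij: "i < length p" "j < length p" for i j
  proof -
    have mod: "Suc k mod length p < length p" for k using ij by (intro mod_less_divisor) auto
    have "(?xs ! i, ?xs ! j) \<in> arc_to_ends G ` set p \<longleftrightarrow>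
      (\<exists>k < length p. ?xs ! k = ?xs ! i \<and> head G (p ! k) = ?xs ! j)"
      unfolding set_conv_nth[of p] using ij by (auto simp: arc_to_ends_def image_iff)
    also have "\<dots> \<longleftrightarrow> (\<exists>k < length p. k = i \<and> ?xs ! (Suc k mod length p) = ?xs ! j)"
      using dist ij cyc_map_tail(2)[OF p] by (metis length_map nth_eq_iff_index_eq)
    also have "\<dots> \<longleftrightarrow> j = Suc i mod length p"
      using dist ij mod nth_eq_iff_index_eq[OF dist] by auto
    finally show ?thesis .
  qed
  have "(\<exists>u v. chord G p u v) \<longleftrightarrow> (\<exists>i < length p. \<exists>j < length p. ?xs ! i \<rightarrow> ?xs ! j \<and>
      j \<noteq> Suc i mod length p \<and> i \<noteq> Suc j mod length p)"
  proof
    assume "\<exists>u v. chord G p u v"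
    then obtain u v where uv: "chord G p u v" by blast
    then have "u \<in> set ?xs" "v \<in> set ?xs" by (auto simp: chord_def cycle_verts_def)
    then obtain i j where "i < length p" "?xs ! i = u" "j < length p" "?xs ! j = v"
      by (metis in_set_conv_nth length_map)
    with uv ends show "\<exists>i < length p. \<exists>j < length p. ?xs ! i \<rightarrow> ?xs ! j \<and>
      j \<noteq> Suc i mod length p \<and> i \<noteq> Suc j mod length p"
      unfolding chord_def by metis
  next
    assume "\<exists>i < length p. \<exists>j < length p. ?xs ! i \<rightarrow> ?xs ! j \<and>
      j \<noteq> Suc i mod length p \<and> i \<noteq> Suc j mod length p"
    then obtain i j where ij: "i < length p" "j < length p" "?xs ! i \<rightarrow> ?xs ! j"
      "j \<noteq> Suc i mod length p" "i \<noteq> Suc j mod length p" by blast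
    then have "chord G p (?xs ! i) (?xs ! j)"
      using ends unfolding chord_def by (auto simp: cycle_verts_def)
    then show "\<exists>u v. chord G p u v" by blast
  qed
  then show ?thesis using p unfolding induced_cycle_def chordless_def length_map by blast
qed

section \<open>Passing from the digraph to its adjacency relation\<close>

lemma (in graph) two_conn_dominates:
  assumes "k_connected 2 G" "3 \<le> min_degree G"
  shows "two_conn (verts G) (dominates G)"
proof
  show "y \<rightarrow> x" if "x \<rightarrow> y" for x y using that by (rule arcs_ends_symmetric[OF sym_arcs])
  show "\<not> x \<rightarrow> x" for x using adj_not_same by blast
  show "x \<in> verts G" if "x \<rightarrow> y" for x y using that by (rule adj_in_verts)
next
  fix x y z
  assume *: "x \<in> verts G" "y \<in> verts G" "z \<in> verts G" "y \<noteq> x" "z \<noteq> x"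
  let ?H = "G \<restriction> (verts G - {x})"
  \<comment> \<open>\<open>k_connected 2\<close> is applied to the singleton \<open>{x}\<close>. In
    a symmetric digraph connectedness is strong, which gives directed reachability.\<close>
  have "connected ?H" using assms(1) * unfolding k_connected_def by auto
  moreover interpret H: wf_digraph ?H by (unfold_locales) auto
  have "symmetric ?H" using sym_arcs unfolding symmetric_conv by fastforce
  ultimately have "strongly_connected ?H" by (intro H.symmetric_connected_imp_strongly_connected)
  then have "y \<rightarrow>\<^sup>*\<^bsub>?H\<^esub> z" using * by (auto simp: strongly_connected_def)
  then have "(y, z) \<in> (arcs_ends ?H)\<^sup>*" by (rule reachable_rtranclI)
  then show "(\<lambda>u v. u \<rightarrow> v \<and> u \<noteq> x \<and> v \<noteq> x)\<^sup>*\<^sup>* y z"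
  proof (induction rule: rtrancl_induct)
    case (step v w)
    then have "v \<rightarrow> w \<and> v \<noteq> x \<and> w \<noteq> x" by (auto simp: arcs_ends_conv)
    with step.IH show ?case by (rule rtranclp.rtrancl_into_rtrancl)
  qed simp
next
  fix x a b
  assume x: "x \<in> verts G"
  have "min_degree G \<le> out_degree G x" unfolding min_degree_def using x by (intro Min_le) auto
  then have "3 \<le> card (out_arcs G x)" using assms(2) by (simp add: out_degree_def)
  \<comment> \<open>Without parallel arcs, distinct arcs leaving \<open>x\<close> have distinct
    heads, so the out-degree counts neighbours.\<close>
  also have "\<dots> = card (head G ` out_arcs G x)"
    by (intro card_image[symmetric] inj_onI no_multi_arcs) (auto simp: arc_to_ends_def)
  finally have "\<not> head G ` out_arcs G x \<subseteq> {a, b}"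
    using card_mono[of "{a, b}" "head G ` out_arcs G x"] card_insert_le_m1[of 2 "{b}" a] by auto
  then obtain e where "e \<in> arcs G" "tail G e = x" "head G e \<noteq> a" "head G e \<noteq> b"
    unfolding out_arcs_def by blast
  then show "\<exists>y. x \<rightarrow> y \<and> y \<noteq> a \<and> y \<noteq> b"
    by (intro exI[of _ "head G e"]) (auto intro: dominatesI simp: arc_to_ends_def)
qed

theorem theorem1:
  fixes G :: "('a, 'b) pre_digraph"
  assumes "graph G"
    and "k_connected 2 G"
    and "\<not> hamiltonian G"
    and "3 \<le> min_degree G"
    and "induced_circumference G \<le> 6"
  shows "circumference G \<ge> induced_circumference G + 2"
proof (rule ccontr)
  assume short: "\<not> ?thesis"
  interpret graph G by fact
  interpret two_conn "verts G" "dominates G" by (rule two_conn_dominates) fact+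
  have len: "length p \<le> card (verts G)" if "ucycle G p" for p
  proof -
    have "distinct (map (tail G) p)" using cyc_map_tail(1)[OF that] by (simp add: cyc_def)
    moreover have "set (map (tail G) p) \<subseteq> verts G" by (rule cyc_V[OF cyc_map_tail(1)[OF that]])
    ultimately show ?thesis
      by (metis card_mono distinct_card finite_verts length_map)
  qed
  \<comment> \<open>Stated for any class of cycles, so that it serves the maxima in both
    circumferences.\<close>
  have fin: "finite {length p | p. Q p}" if "\<And>p. Q p \<Longrightarrow> ucycle G p" for Q
    by (rule finite_subset[of _ "{..card (verts G)}"]) (use that len in auto)
  \<comment> \<open>\<open>Max\<close> of the empty set is unspecified, so an induced cycle must be
    exhibited before the maximum can be attained; a shortest cycle is one.\<close>
  have "\<exists>p. induced_cycle G p"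
  proof -
    have "verts G \<noteq> {}" using assms(2) by (auto simp: k_connected_def)
    then obtain xs where "cyc (dominates G) xs" "\<And>ys. cyc (dominates G) ys \<Longrightarrow> length xs \<le> length ys"
      using ex_cyc ex_has_least_nat[of "cyc (dominates G)" _ length] by blast
    with shortest_cyc_chordless have "cyc (dominates G) xs" "chordless (dominates G) xs" by auto
    then show ?thesis using induced_cycle_iff_chordless by (metis ex_ucycle)
  qed
  then have "induced_circumference G \<in> {length p | p. induced_cycle G p}"
    unfolding induced_circumference_def
    by (intro Max_in fin) (auto simp: induced_cycle_def)
  then obtain p where p: "induced_cycle G p" "length p = induced_circumference G" by auto
  then have up: "ucycle G p" by (simp add: induced_cycle_def)
  have "circ_le (length p + 1)"
    unfolding circ_le_def
  proof (intro allI impI)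
    fix ys assume "cyc (dominates G) ys"
    then obtain q where "ucycle G q" "map (tail G) q = ys" by (rule ex_ucycle)
    then have "length ys \<le> circumference G"
      unfolding circumference_def by (intro Max_ge fin) auto
    then show "length ys \<le> length p + 1" using short p by simp
  qed
  moreover have "\<not> circ_le (length (map (tail G) p) + 1)"
  proof (rule circ_gt_chordless)
    show "cyc (dominates G) (map (tail G) p)" by (rule cyc_map_tail(1)[OF up])
    show "chordless (dominates G) (map (tail G) p)"
      using p up induced_cycle_iff_chordless by blast
    show "length (map (tail G) p) \<le> 6" using p assms(5) by simp
    show "set ys \<noteq> verts G" if ys: "cyc (dominates G) ys" for ys
    proof -
      obtain q where "ucycle G q" "map (tail G) q = ys" using ys by (rule ex_ucycle)
      with assms(3) show ?thesis by (auto simp: hamiltonian_def cycle_verts_def)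
    qed
  qed
  ultimately show False by simp
qed

end
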